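(* For $n\ge 2$, let $X_n$ be the number of left-to-right maxima of a permutation chosen uniformly at random among the permutations of length $n$ lying in $\bigcup_{p\ge 0}\mathcal{B}_p$ (equivalently, such a permutation lies in $\mathcal{B}_p$ with $p=n-1-X_n$). Then $\mathbb{E}[X_n]\sim \frac{\ln n}{\sqrt5}$ as $n\to\infty$, and $X_n$ has Gaussian fluctuations: $(X_n-\mathbb{E}[X_n])/\sqrt{\operatorname{Var}(X_n)}$ converges in distribution to the standard normal law. In particular the typical $p$ with the random permutation in $\mathcal{B}_p$ satisfies $p\sim n-\frac{\ln n}{\sqrt5}$.
   Context: A left-to-right maximum of $\sigma=\sigma_1\cdots\sigma_n$ is an entry $\sigma_i$ with $\sigma_k<\sigma_i$ for all $k<i$; other entries are non-left-to-right-maxima. A right-jump transforms $\sigma$ into $\sigma_1\cdots\sigma_{i-1}\sigma_{i+1}\cdots\sigma_j\sigma_i\sigma_{j+1}\cdots\sigma_n$ for some $1\le i<j\le n$. A permutation $\pi$ is a pattern of $\sigma$ if some subsequence of $\sigma$ is order-isomorphic to $\pi$. $\mathcal{C}_p$ is the set of permutations (of any length $n$) obtainable from the identity $12\cdots n$ by at most $p$ right-jumps; the basis $\mathcal{B}_p$ is the set of permutations not in $\mathcal{C}_p$ all of whose proper patterns lie in $\mathcal{C}_p$. A permutation in $\mathcal{B}_p$ has exactly $p+1$ non-left-to-right-maxima. *)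

theory Defs
  imports "HOL-Probability.Probability" "HOL-Library.Sublist" "HOL-Library.Landau_Symbols"
begin

text \<open>Permutations of length n are lists of the distinct values 0,...,n-1
  (only the relative order of entries matters).\<close>
definition is_perm :: "nat list \<Rightarrow> bool" where
  "is_perm xs \<longleftrightarrow> distinct xs \<and> set xs = {0..<length xs}"

definition ltr_max :: "nat list \<Rightarrow> nat \<Rightarrow> bool" where
  "ltr_max xs i \<longleftrightarrow> i < length xs \<and> (\<forall>k<i. xs ! k < xs ! i)"

definition num_ltr_max :: "nat list \<Rightarrow> nat" where
  "num_ltr_max xs = card {i. ltr_max xs i}"

text \<open>Right-jump: move the entry at (0-indexed) position i to position j, with i < j.\<close>
definition right_jump :: "nat list \<Rightarrow> nat list \<Rightarrow> bool" where
  "right_jump xs ys \<longleftrightarrow> (\<exists>i j. i < j \<and> j < length xs \<and>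
     ys = take i xs @ take (j - i) (drop (Suc i) xs) @ [xs ! i] @ drop (Suc j) xs)"

definition C :: "nat \<Rightarrow> nat list set" where
  "C p = {\<sigma>. \<exists>k\<le>p. (right_jump ^^ k) [0..<length \<sigma>] \<sigma>}"

definition order_iso :: "nat list \<Rightarrow> nat list \<Rightarrow> bool" where
  "order_iso xs ys \<longleftrightarrow> length xs = length ys \<and>
     (\<forall>i<length xs. \<forall>j<length xs. xs ! i < xs ! j \<longleftrightarrow> ys ! i < ys ! j)"

definition is_pattern :: "nat list \<Rightarrow> nat list \<Rightarrow> bool" where
  "is_pattern \<pi> \<sigma> \<longleftrightarrow> is_perm \<pi> \<and> (\<exists>s. subseq s \<sigma> \<and> order_iso \<pi> s)"

definition B :: "nat \<Rightarrow> nat list set" where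
  "B p = {\<sigma>. is_perm \<sigma> \<and> \<sigma> \<notin> C p \<and>
     (\<forall>\<pi>. is_pattern \<pi> \<sigma> \<and> length \<pi> < length \<sigma> \<longrightarrow> \<pi> \<in> C p)}"

definition basis_perms :: "nat \<Rightarrow> nat list set" where
  "basis_perms n = {\<sigma>. length \<sigma> = n \<and> (\<exists>p. \<sigma> \<in> B p)}"

definition U :: "nat \<Rightarrow> nat list pmf" where
  "U n = pmf_of_set (basis_perms n)"

definition meanX :: "nat \<Rightarrow> real" where
  "meanX n = measure_pmf.expectation (U n) (\<lambda>\<sigma>. real (num_ltr_max \<sigma>))"

definition VarX :: "nat \<Rightarrow> real" where
  "VarX n = measure_pmf.variance (U n) (\<lambda>\<sigma>. real (num_ltr_max \<sigma>))"

end

theory Submission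
  imports Defs "HOL-Combinatorics.Multiset_Permutations"
    "HOL-Complex_Analysis.Complex_Analysis" "HOL-Real_Asymp.Real_Asymp"
begin

text \<open>
  A permutation lies in \<open>C p\<close> iff it has at most \<open>p\<close> entries that are not left-to-right maxima,
  so a nonempty permutation is in the basis iff deleting any left-to-right maximum \<open>v\<close> creates a new
  one, i.e. iff some later entry has \<open>v\<close> as its only larger predecessor. Reading a permutation
  from left to right, this says that every record is followed by an entry that is second largest
  so far, before the next record and before the end. Hence the generating polynomial by left-to-right
  maxima satisfies a \<open>2 \<times> 2\<close> linear recursion, whose solution is explicit: at \<open>u = x (x + 1)\<close> it is
  \<open>((x + 1) x\<^bsup>(n)\<^esup> + x (-1 - x)\<^bsup>(n)\<^esup>) / (1 + 2 x)\<close> with rising factorials.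

  Put \<open>g = (sqrt 5 - 1) / 2\<close>, the value of \<open>x\<close> at \<open>u = 1\<close>, and \<open>H = (\<Sum>i<n. 1 / (g + i))\<close>. The
  probability generating function is \<open>k(x) exp ((x - g) H)\<close>, where \<open>k\<close> is bounded near \<open>g\<close>
  uniformly in \<open>n\<close>. By Cauchy's inequality so are \<open>k'\<close> and \<open>k''\<close>; hence
  \<open>sqrt 5 E[X] = H + k'(g)\<close> and \<open>5 Var X - 3 E[X] = k''(g) - k'(g)\<^sup>2\<close> give the moments up to bounded
  errors, and the characteristic functions converge.
\<close>

section \<open>Left-to-right maxima and the basis\<close>

text \<open>Values are collected, not positions: a value keeps its identity when other entries are
  moved or deleted.\<close>

definition lrm :: "nat list \<Rightarrow> nat set" where
  "lrm xs = (!) xs ` {i. ltr_max xs i}"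

definition nonmax :: "nat list \<Rightarrow> nat" where
  "nonmax xs = length xs - card (lrm xs)"

lemma ltr_max_append:
  "{i. ltr_max (xs @ ys) i} =
     {i. ltr_max xs i} \<union> (+) (length xs) ` {i. ltr_max ys i \<and> (\<forall>z\<in>set xs. z < ys ! i)}"
  (is "?L = ?R")
proof (intro set_eqI iffI)
  fix i assume i: "i \<in> ?L"
  show "i \<in> ?R"
  proof (cases "i < length xs")
    case True
    then show ?thesis using i by (auto simp: ltr_max_def nth_append)
  next
    case False
    define j where "j = i - length xs"
    have ij: "i = length xs + j" using False by (simp add: j_def)
    have j: "j < length ys" using i ij by (auto simp: ltr_max_def)
    have all: "\<forall>k<i. (xs @ ys) ! k < ys ! j"
      using i ij by (auto simp: ltr_max_def)
    have "ys ! k < ys ! j" if "k < j" for k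
      using all[rule_format, of "length xs + k"] ij that by simp
    moreover have "xs ! k < ys ! j" if "k < length xs" for k
      using all[rule_format, of k] ij that by (simp add: nth_append)
    then have "\<forall>z\<in>set xs. z < ys ! j"
      by (auto simp: in_set_conv_nth)
    ultimately show ?thesis using ij j by (auto simp: ltr_max_def)
  qed
next
  fix i assume "i \<in> ?R"
  then show "i \<in> ?L"
    by (auto simp: ltr_max_def nth_append)
qed

lemma lrm_append: "lrm (xs @ ys) = lrm xs \<union> {y \<in> lrm ys. \<forall>z\<in>set xs. z < y}"
proof -
  have "(!) (xs @ ys) ` {i. ltr_max xs i} = lrm xs"
    unfolding lrm_def by (rule image_cong) (auto simp: ltr_max_def nth_append)
  moreover have "(!) (xs @ ys) ` (+) (length xs) ` {i. ltr_max ys i \<and> (\<forall>z\<in>set xs. z < ys ! i)} =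
      {y \<in> lrm ys. \<forall>z\<in>set xs. z < y}"
    by (auto simp: image_image lrm_def)
  ultimately show ?thesis
    by (subst lrm_def) (simp only: ltr_max_append image_Un)
qed

lemma lrm_Nil [simp]: "lrm [] = {}"
  by (auto simp: lrm_def ltr_max_def)

lemma lrm_single: "lrm [x] = {x}"
  by (auto simp: lrm_def ltr_max_def)

lemma lrm_Cons: "lrm (x # xs) = insert x {y \<in> lrm xs. x < y}"
  using lrm_append[of "[x]" xs] by (auto simp: lrm_single)

lemma lrm_subset: "lrm xs \<subseteq> set xs"
  by (auto simp: lrm_def ltr_max_def)

lemma finite_lrm [simp]: "finite (lrm xs)"
  using lrm_subset finite_subset by blast

lemma card_lrm_le: "card (lrm xs) \<le> length xs"
  using card_mono[OF _ lrm_subset, of xs] card_length[of xs] by simp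

lemma card_lrm: "card (lrm xs) = num_ltr_max xs"
proof -
  have "inj_on ((!) xs) {i. ltr_max xs i}"
    by (rule inj_onI) (metis ltr_max_def mem_Collect_eq nat_neq_iff)
  then show ?thesis by (simp add: lrm_def num_ltr_max_def card_image)
qed

lemma lrm_sorted:
  assumes "sorted xs" "distinct xs"
  shows "lrm xs = set xs"
  using assms
proof (induction xs rule: rev_induct)
  case (snoc x xs)
  then show ?case by (auto simp: lrm_append lrm_single sorted_append less_le)
qed simp

lemma nonmax_upt: "nonmax [0..<n] = 0"
  by (simp add: nonmax_def lrm_sorted)

section \<open>Right-jumps and the number of entries that are not left-to-right maxima\<close>

lemma right_jump_iff:
  "right_jump xs ys \<longleftrightarrow>
     (\<exists>as x bs cs. bs \<noteq> [] \<and> xs = as @ x # bs @ cs \<and> ys = as @ bs @ x # cs)"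
  (is "_ \<longleftrightarrow> ?R")
proof
  assume "right_jump xs ys"
  then obtain i j where ij: "i < j" "j < length xs"
    and ys: "ys = take i xs @ take (j - i) (drop (Suc i) xs) @ [xs ! i] @ drop (Suc j) xs"
    by (auto simp: right_jump_def)
  have "drop (Suc i) xs = take (j - i) (drop (Suc i) xs) @ drop (j - i) (drop (Suc i) xs)"
    by (simp only: append_take_drop_id)
  also have "drop (j - i) (drop (Suc i) xs) = drop (Suc j) xs"
    using ij by simp
  finally have d: "drop (Suc i) xs = take (j - i) (drop (Suc i) xs) @ drop (Suc j) xs" .
  have "xs = take i xs @ xs ! i # take (j - i) (drop (Suc i) xs) @ drop (Suc j) xs"
    using ij by (intro trans[OF id_take_nth_drop[of i xs]]) (simp_all only: d[symmetric])
  moreover have "take (j - i) (drop (Suc i) xs) \<noteq> []" using ij by simp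
  ultimately show ?R using ys by (metis append_Cons append_Nil)
next
  assume ?R
  then obtain as x bs cs where "bs \<noteq> []" "xs = as @ x # bs @ cs" "ys = as @ bs @ x # cs"
    by blast
  then show "right_jump xs ys"
    unfolding right_jump_def
    by (intro exI[of _ "length as"] exI[of _ "length as + length bs"]) auto
qed

text \<open>The entries jumped over lose the predecessor \<open>x\<close>, and all others except
  \<open>x\<close> keep their predecessors. Hence only \<open>x\<close> itself can cease to be a
  left-to-right maximum.\<close>

lemma nonmax_right_jump:
  assumes "right_jump xs ys"
  shows "nonmax ys \<le> Suc (nonmax xs)"
proof -
  obtain as x bs cs where eq: "xs = as @ x # bs @ cs" "ys = as @ bs @ x # cs"
    using assms by (auto simp: right_jump_iff)
  have "lrm xs \<subseteq> insert x (lrm ys)"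
    unfolding eq by (auto simp: lrm_append lrm_Cons)
  then have "card (lrm xs) \<le> card (insert x (lrm ys))" by (intro card_mono) auto
  also have "\<dots> \<le> Suc (card (lrm ys))" by (simp add: card_insert_if)
  finally have "card (lrm xs) \<le> Suc (card (lrm ys))" .
  then show ?thesis
    using card_lrm_le[of xs] card_lrm_le[of ys] eq by (simp add: nonmax_def)
qed

text \<open>The second case locates the first failure of sortedness, which
  \<open>relpowp_right_jump\<close> repairs by moving \<open>x\<close> back to the left.\<close>

lemma sorted_or_descent:
  fixes xs :: "nat list"
  shows "sorted xs \<or> (\<exists>as x cs. xs = as @ x # cs \<and> sorted as \<and> (\<exists>y\<in>set as. x < y))"
proof (induction xs rule: rev_induct)
  case (snoc x xs)
  then show ?case
  proof (elim disjE exE conjE)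
    assume "sorted xs"
    then show ?thesis
      by (cases "\<exists>y\<in>set xs. x < y") (blast, auto simp: sorted_append not_less)
  next
    fix as x' cs
    assume "xs = as @ x' # cs" "sorted as" "\<exists>y\<in>set as. x' < y"
    then show ?thesis
      by (intro disjI2 exI[of _ as] exI[of _ x'] exI[of _ "cs @ [x]"]) auto
  qed
qed simp

lemma is_perm_sorted:
  assumes "is_perm xs" "sorted xs"
  shows "xs = [0..<length xs]"
  using assms by (intro sorted_distinct_set_unique) (auto simp: is_perm_def)

text \<open>A right-jump is undone at the first descent: \<open>x\<close> is moved left to its place
  in the sorted prefix. It becomes a left-to-right maximum there and no other entry changes its
  status, so the number of non-maxima drops by exactly one.\<close>

lemma relpowp_right_jump:
  "is_perm \<sigma> \<Longrightarrow> (right_jump ^^ nonmax \<sigma>) [0..<length \<sigma>] \<sigma>"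
proof (induction "nonmax \<sigma>" arbitrary: \<sigma>)
  case 0
  have "sorted \<sigma>"
  proof (rule ccontr)
    assume "\<not> sorted \<sigma>"
    then obtain as x cs where eq: "\<sigma> = as @ x # cs" "\<exists>y\<in>set as. x < y"
      using sorted_or_descent by blast
    have "x \<notin> lrm \<sigma>"
      using eq 0(2) lrm_subset[of as] lrm_subset[of cs]
      by (auto simp: is_perm_def lrm_append lrm_Cons) (meson less_asym)
    then have "lrm \<sigma> \<subset> set \<sigma>" using lrm_subset[of \<sigma>] eq(1) by auto
    then have "card (lrm \<sigma>) < length \<sigma>"
      using 0(2) by (metis psubset_card_mono List.finite_set distinct_card is_perm_def)
    then show False using 0(1) by (simp add: nonmax_def)
  qed
  then have "\<sigma> = [0..<length \<sigma>]" by (rule is_perm_sorted[OF 0(2)])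
  then show ?case using 0 by (metis relpowp_0_I)
next
  case (Suc k)
  have "\<not> sorted \<sigma>"
    using Suc.hyps(2) is_perm_sorted[OF Suc.prems] nonmax_upt by (metis nat.distinct(1))
  then obtain as x cs where eq: "\<sigma> = as @ x # cs" and srt: "sorted as" and ex: "\<exists>y\<in>set as. x < y"
    using sorted_or_descent by blast
  have dist: "distinct (as @ x # cs)" using Suc.prems eq by (simp add: is_perm_def)
  \<comment> \<open>Sortedness of \<open>as\<close> makes \<open>as1\<close> the entries below
    \<open>x\<close> and \<open>as2\<close> the nonempty rest above it; \<open>x\<close> belongs
    between them.\<close>
  define as1 where "as1 = takeWhile (\<lambda>y. y < x) as"
  define as2 where "as2 = dropWhile (\<lambda>y. y < x) as"
  have as: "as = as1 @ as2" by (simp add: as1_def as2_def)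
  have as1: "\<forall>y\<in>set as1. y < x" by (auto simp: as1_def dest: set_takeWhileD)
  have ne: "as2 \<noteq> []" using as1 ex as by auto
  have "\<not> hd as2 < x" using ne unfolding as2_def by (metis hd_dropWhile)
  moreover have "\<forall>y\<in>set as2. hd as2 \<le> y"
    using srt ne unfolding as by (cases as2) (auto simp: sorted_append)
  ultimately have as2: "\<forall>y\<in>set as2. x < y"
    using dist as by (auto simp: not_less) (metis le_less order_trans)
  define \<tau> where "\<tau> = as1 @ x # as2 @ cs"
  have jump: "right_jump \<tau> \<sigma>"
    unfolding right_jump_iff \<tau>_def using ne eq as by auto
  have "lrm as1 = set as1" "lrm as2 = set as2"
    using srt dist unfolding as by (simp_all add: sorted_append lrm_sorted)
  moreover have a12: "\<forall>y\<in>set as1. \<forall>z\<in>set as2. y < z"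
    using as1 as2 by (meson less_trans)
  moreover obtain y0 where y0: "y0 \<in> set as2" using ne by (meson last_in_set)
  ultimately have lrm\<tau>: "lrm \<tau> = insert x (lrm \<sigma>)"
    using as1 as2 a12 y0 unfolding \<tau>_def eq as by (auto simp: lrm_append lrm_Cons)
  have "x \<notin> lrm \<sigma>"
    using ex dist lrm_subset[of as] lrm_subset[of cs] unfolding eq
    by (auto simp: lrm_append lrm_Cons) (meson less_asym)
  then have "k = nonmax \<tau>"
    using lrm\<tau> Suc.hyps(2) eq as by (auto simp: nonmax_def \<tau>_def)
  moreover have perm: "is_perm \<tau>"
    using Suc.prems eq as unfolding is_perm_def \<tau>_def by auto
  ultimately have "(right_jump ^^ k) [0..<length \<tau>] \<tau>" using Suc.hyps(1) by blast
  moreover have "length \<tau> = length \<sigma>" using eq as by (simp add: \<tau>_def)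
  ultimately have "(right_jump ^^ Suc k) [0..<length \<sigma>] \<sigma>"
    using jump by (metis relpowp_Suc_I)
  then show ?case using Suc.hyps(2) by simp
qed

text \<open>The identity has no non-maxima and each jump creates at most one, so at least
  \<open>nonmax \<sigma>\<close> jumps are needed; \<open>relpowp_right_jump\<close> shows that this
  many suffice.\<close>

lemma C_iff:
  assumes "is_perm \<sigma>"
  shows "\<sigma> \<in> C p \<longleftrightarrow> nonmax \<sigma> \<le> p"
proof
  have *: "nonmax ys \<le> nonmax xs + k" if "(right_jump ^^ k) xs ys" for k xs ys
    using that
  proof (induction k arbitrary: ys)
    case (Suc k)
    then obtain zs where "(right_jump ^^ k) xs zs" "right_jump zs ys" by (metis relpowp_Suc_E)
    then show ?case using Suc.IH nonmax_right_jump by fastforce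
  qed simp
  assume "\<sigma> \<in> C p"
  then show "nonmax \<sigma> \<le> p"
    using *[of _ "[0..<length \<sigma>]" \<sigma>] by (fastforce simp: C_def nonmax_upt)
next
  assume "nonmax \<sigma> \<le> p"
  then show "\<sigma> \<in> C p" using relpowp_right_jump[OF assms] by (auto simp: C_def)
qed

section \<open>Deleting one entry\<close>

text \<open>For distinct entries these are exactly the ones that turn into left-to-right maxima when
  \<open>v\<close> is deleted.\<close>

definition only_dominated_by :: "nat \<Rightarrow> nat list \<Rightarrow> nat set" where
  "only_dominated_by v xs = {x. \<exists>as bs. xs = as @ x # bs \<and> {z \<in> set as. x < z} = {v}}"

definition sole_dominators :: "nat list \<Rightarrow> nat set" where
  "sole_dominators xs = {v. only_dominated_by v xs \<noteq> {}}"

lemma only_dominated_by_Nil [simp]: "only_dominated_by v [] = {}"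
  by (simp add: only_dominated_by_def)

lemma only_dominated_by_snoc:
  "only_dominated_by v (xs @ [x]) =
     only_dominated_by v xs \<union> (if {z \<in> set xs. x < z} = {v} then {x} else {})" (is "?L = ?R")
proof (intro set_eqI iffI)
  fix y assume "y \<in> ?L"
  then obtain as bs where *: "xs @ [x] = as @ y # bs" "{z \<in> set as. y < z} = {v}"
    by (auto simp: only_dominated_by_def)
  show "y \<in> ?R"
  proof (cases bs rule: rev_cases)
    case Nil
    then show ?thesis using * by simp
  next
    case (snoc cs c)
    then have "xs = as @ y # cs" using * by simp
    then show ?thesis using * by (auto simp: only_dominated_by_def)
  qed
next
  fix y assume "y \<in> ?R"
  then consider "y \<in> only_dominated_by v xs" | "y = x" "{z \<in> set xs. x < z} = {v}"
    by (auto split: if_splits)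
  then show "y \<in> ?L"
  proof cases
    case 1
    then obtain as bs where "xs = as @ y # bs" "{z \<in> set as. y < z} = {v}"
      by (auto simp: only_dominated_by_def)
    then have "xs @ [x] = as @ y # (bs @ [x])" by simp
    then show ?thesis using \<open>{z \<in> set as. y < z} = {v}\<close> unfolding only_dominated_by_def by blast
  next
    case 2
    then show ?thesis unfolding only_dominated_by_def by blast
  qed
qed

lemma only_dominated_by_subset: "only_dominated_by v xs \<subseteq> set xs"
proof
  fix x assume "x \<in> only_dominated_by v xs"
  then obtain as bs where "xs = as @ x # bs" unfolding only_dominated_by_def by blast
  then show "x \<in> set xs" by simp
qed

lemma sole_dominators_snoc: "sole_dominators (xs @ [x]) = sole_dominators xs \<union> {v. {z \<in> set xs. x < z} = {v}}"
  by (auto simp: sole_dominators_def only_dominated_by_snoc)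

lemma sole_dominators_Nil [simp]: "sole_dominators [] = {}"
  by (simp add: sole_dominators_def)

lemma sole_dominators_subset: "sole_dominators xs \<subseteq> set xs"
  by (induction xs rule: rev_induct) (auto simp: sole_dominators_snoc)

lemma lrm_snoc: "lrm (xs @ [x]) = lrm xs \<union> (if \<forall>y\<in>set xs. y < x then {x} else {})"
  by (auto simp: lrm_append lrm_single)

text \<open>Deleting \<open>v\<close> removes at most \<open>v\<close> from the larger predecessors
  of an entry. A remaining entry is therefore a maximum afterwards iff these predecessors formed the
  empty set (an old maximum) or \<open>{v}\<close> (a new one).\<close>

lemma lrm_filter:
  "distinct xs \<Longrightarrow> lrm (filter (\<lambda>x. x \<noteq> v) xs) = (lrm xs - {v}) \<union> only_dominated_by v xs"
proof (induction xs rule: rev_induct)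
  case (snoc x xs)
  have IH: "lrm (filter (\<lambda>x. x \<noteq> v) xs) = (lrm xs - {v}) \<union> only_dominated_by v xs"
    and x: "x \<notin> set xs"
    using snoc by auto
  show ?case
  proof (cases "x = v")
    case True
    have "{z \<in> set xs. x < z} \<noteq> {v}" using True by auto
    then show ?thesis using IH True by (auto simp: lrm_snoc only_dominated_by_snoc)
  next
    case False
    have nlt: "y < x \<longleftrightarrow> \<not> x < y" if "y \<in> set xs" for y
      using x that by (cases "x = y") auto
    have "(\<forall>y\<in>set (filter (\<lambda>x. x \<noteq> v) xs). y < x) \<longleftrightarrow> {z \<in> set xs. x < z} \<subseteq> {v}"
      by (auto simp: nlt)
    moreover have "(\<forall>y\<in>set xs. y < x) \<longleftrightarrow> {z \<in> set xs. x < z} = {}"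
      by (auto simp: nlt)
    moreover have "filter (\<lambda>x. x \<noteq> v) (xs @ [x]) = filter (\<lambda>x. x \<noteq> v) xs @ [x]"
      using False by simp
    ultimately show ?thesis
      using IH False by (auto simp only: lrm_snoc only_dominated_by_snoc subset_singleton_iff split: if_splits)
  qed
qed simp

lemma lrm_only_dominated_by_disjoint:
  "distinct xs \<Longrightarrow> lrm xs \<inter> only_dominated_by v xs = {}"
proof (induction xs rule: rev_induct)
  case (snoc x xs)
  then show ?case
    using lrm_subset[of xs] only_dominated_by_subset[of v xs]
    by (auto simp: lrm_snoc only_dominated_by_snoc)
      (metis (mono_tags, lifting) less_asym mem_Collect_eq singletonI)
qed simp

text \<open>The length drops by one, \<open>v\<close> is lost as a maximum if it was one, and every
  entry of \<open>only_dominated_by v xs\<close> is gained. So \<open>nonmax\<close> decreases by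
  \<open>card (only_dominated_by v xs)\<close>, plus one if \<open>v\<close> was not a
  maximum.\<close>

lemma nonmax_delete:
  assumes "distinct xs" "v \<in> set xs"
  shows "nonmax (filter (\<lambda>x. x \<noteq> v) xs) \<le> nonmax xs"
    and "nonmax (filter (\<lambda>x. x \<noteq> v) xs) < nonmax xs \<longleftrightarrow> (v \<in> lrm xs \<longrightarrow> v \<in> sole_dominators xs)"
proof -
  let ?ys = "filter (\<lambda>x. x \<noteq> v) xs"
  have fin: "finite (only_dominated_by v xs)"
    using only_dominated_by_subset finite_subset by blast
  have "set ?ys = set xs - {v}" by auto
  then have "length ?ys = card (set xs - {v})"
    using distinct_card[of ?ys] assms(1) by simp
  then have "Suc (length ?ys) = length xs"
    using assms length_pos_if_in_set[OF assms(2)] by (simp add: distinct_card)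
  moreover have "card (lrm ?ys) = card (lrm xs - {v}) + card (only_dominated_by v xs)"
    using lrm_filter[OF assms(1)] lrm_only_dominated_by_disjoint[OF assms(1)] fin
    by (auto intro!: card_Un_disjoint)
  moreover have "card (only_dominated_by v xs) = 0 \<longleftrightarrow> v \<notin> sole_dominators xs"
    using fin by (simp add: sole_dominators_def)
  moreover have "card (lrm xs - {v}) = card (lrm xs) - (if v \<in> lrm xs then 1 else 0)"
    by (simp add: card_Diff_singleton_if)
  moreover have "v \<in> lrm xs \<Longrightarrow> card (lrm xs) > 0"
    by (auto simp: card_gt_0_iff)
  ultimately show "nonmax ?ys \<le> nonmax xs"
    and "nonmax ?ys < nonmax xs \<longleftrightarrow> (v \<in> lrm xs \<longrightarrow> v \<in> sole_dominators xs)"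
    using card_lrm_le[of xs] card_lrm_le[of ?ys] unfolding nonmax_def
    by (auto split: if_splits)
qed

section \<open>Patterns and the description of the basis\<close>

lemma proper_subseq_delete:
  assumes "distinct xs" "subseq s xs" "length s < length xs"
  obtains v where "v \<in> set xs" "subseq s (filter (\<lambda>x. x \<noteq> v) xs)"
proof -
  have "card (set s) < card (set xs)"
    using assms card_length[of s] by (simp add: distinct_card)
  then obtain v where v: "v \<in> set xs" "v \<notin> set s"
    by (metis List.finite_set card_mono leD subsetI)
  then have "filter (\<lambda>x. x \<noteq> v) s = s" by (auto simp: filter_id_conv)
  then have "subseq s (filter (\<lambda>x. x \<noteq> v) xs)" using assms(2) subseq_filter by metis
  then show ?thesis using v that by blast
qed

text \<open>A subsequence arises by deleting entries one at a time, and no single deletion increases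
  \<open>nonmax\<close>.\<close>

lemma nonmax_subseq:
  assumes "distinct xs" "subseq s xs"
  shows "nonmax s \<le> nonmax xs"
  using assms
proof (induction "length xs" arbitrary: xs rule: less_induct)
  case less
  show ?case
  proof (cases "length s < length xs")
    case True
    then obtain v where v: "v \<in> set xs" "subseq s (filter (\<lambda>x. x \<noteq> v) xs)"
      using proper_subseq_delete less.prems by metis
    then have "nonmax s \<le> nonmax (filter (\<lambda>x. x \<noteq> v) xs)"
      using less.prems(1) by (intro less.hyps) (auto intro: length_filter_less)
    then show ?thesis using nonmax_delete(1)[OF less.prems(1) v(1)] by simp
  next
    case False
    then have "length s = length xs" using list_emb_length[OF less.prems(2)] by simp
    then have "s = xs" using less.prems(2) by (simp add: subseq_same_length)
    then show ?thesis by simp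
  qed
qed

lemma nonmax_order_iso:
  assumes "order_iso xs ys"
  shows "nonmax xs = nonmax ys"
proof -
  have "{i. ltr_max xs i} = {i. ltr_max ys i}"
    using assms by (auto simp: order_iso_def ltr_max_def)
  then show ?thesis using assms
    by (simp add: nonmax_def card_lrm num_ltr_max_def order_iso_def)
qed

lemma ex_perm_order_iso:
  assumes "distinct s"
  shows "\<exists>\<pi>. is_perm \<pi> \<and> order_iso \<pi> s"
proof -
  \<comment> \<open>Standardisation: each value is replaced by its rank within
    \<open>s\<close>.\<close>
  define f where "f = (\<lambda>x. card {y \<in> set s. y < x})"
  have mono: "f x < f y" if "x \<in> set s" "x < y" for x y
    unfolding f_def using that by (intro psubset_card_mono) auto
  have iff: "f x < f y \<longleftrightarrow> x < y" if "x \<in> set s" "y \<in> set s" for x y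
    using mono that by (metis linorder_neqE_nat order_less_asym less_irrefl)
  have inj: "inj_on f (set s)"
    using mono by (intro inj_onI) (metis linorder_neqE_nat less_irrefl)
  have "f ` set s \<subseteq> {0..<length s}"
    unfolding f_def using assms
    by (auto simp: distinct_card[symmetric] intro!: psubset_card_mono)
  moreover have "card (f ` set s) = card {0..<length s}"
    using inj assms by (simp add: card_image distinct_card)
  ultimately have "f ` set s = {0..<length s}"
    by (intro card_subset_eq) auto
  then have "is_perm (map f s)"
    using assms inj by (simp add: is_perm_def distinct_map)
  moreover have "order_iso (map f s) s"
    using iff by (auto simp: order_iso_def)
  ultimately show ?thesis by blast
qed

text \<open>By \<open>nonmax_subseq\<close>, minimality needs testing only on single deletions, each
  of which must lower \<open>nonmax\<close>; by \<open>nonmax_delete\<close> this concerns the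
  maxima alone. The empty list satisfies the inclusion vacuously but lies in every
  \<open>C p\<close>, so it is excluded explicitly.\<close>

lemma basis_perms_iff:
  "\<sigma> \<in> basis_perms n \<longleftrightarrow>
     length \<sigma> = n \<and> is_perm \<sigma> \<and> \<sigma> \<noteq> [] \<and> lrm \<sigma> \<subseteq> sole_dominators \<sigma>"
proof
  assume "\<sigma> \<in> basis_perms n"
  then obtain p where len: "length \<sigma> = n" and perm: "is_perm \<sigma>" and "\<sigma> \<notin> C p"
    and pat: "\<And>\<pi>. is_pattern \<pi> \<sigma> \<Longrightarrow> length \<pi> < length \<sigma> \<Longrightarrow> \<pi> \<in> C p"
    by (auto simp: basis_perms_def B_def)
  have p: "p < nonmax \<sigma>" using C_iff[OF perm] \<open>\<sigma> \<notin> C p\<close> by simp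
  then have "\<sigma> \<noteq> []" by (auto simp: nonmax_def)
  have dist: "distinct \<sigma>" using perm by (simp add: is_perm_def)
  have "v \<in> sole_dominators \<sigma>" if v: "v \<in> lrm \<sigma>" for v
  proof -
    let ?s = "filter (\<lambda>x. x \<noteq> v) \<sigma>"
    have vin: "v \<in> set \<sigma>" using v lrm_subset by blast
    obtain \<pi> where \<pi>: "is_perm \<pi>" "order_iso \<pi> ?s"
      using ex_perm_order_iso dist distinct_filter by blast
    have "length \<pi> < length \<sigma>"
      using \<pi>(2) vin by (auto simp: order_iso_def intro!: length_filter_less)
    moreover have "is_pattern \<pi> \<sigma>" using \<pi> subseq_filter_left unfolding is_pattern_def by blast
    ultimately have "nonmax \<pi> \<le> p" using pat[of \<pi>] C_iff[OF \<pi>(1), of p] by blast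
    then have "nonmax ?s < nonmax \<sigma>" using p nonmax_order_iso[OF \<pi>(2)] by simp
    then show ?thesis using nonmax_delete(2)[OF dist vin] v by simp
  qed
  then show "length \<sigma> = n \<and> is_perm \<sigma> \<and> \<sigma> \<noteq> [] \<and> lrm \<sigma> \<subseteq> sole_dominators \<sigma>"
    using len perm \<open>\<sigma> \<noteq> []\<close> by auto
next
  assume "length \<sigma> = n \<and> is_perm \<sigma> \<and> \<sigma> \<noteq> [] \<and> lrm \<sigma> \<subseteq> sole_dominators \<sigma>"
  then have len: "length \<sigma> = n" and perm: "is_perm \<sigma>" and ne: "\<sigma> \<noteq> []"
    and sub: "lrm \<sigma> \<subseteq> sole_dominators \<sigma>"
    by auto
  have dist: "distinct \<sigma>" using perm by (simp add: is_perm_def)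
  have del: "nonmax (filter (\<lambda>x. x \<noteq> v) \<sigma>) < nonmax \<sigma>" if "v \<in> set \<sigma>" for v
    using nonmax_delete(2)[OF dist that] sub by auto
  \<comment> \<open>Some entry can be deleted and this lowers \<open>nonmax\<close>, so
    \<open>nonmax \<sigma> - 1\<close> is a genuine predecessor and can serve as
    \<open>p\<close>.\<close>
  from del[of "hd \<sigma>"] have pos: "nonmax \<sigma> > 0" using ne by simp
  have "\<pi> \<in> C (nonmax \<sigma> - 1)" if "is_pattern \<pi> \<sigma>" "length \<pi> < length \<sigma>" for \<pi>
  proof -
    from that obtain s where \<pi>: "is_perm \<pi>" "subseq s \<sigma>" "order_iso \<pi> s"
      by (auto simp: is_pattern_def)
    then have "length s < length \<sigma>" using that by (simp add: order_iso_def)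
    then obtain v where v: "v \<in> set \<sigma>" "subseq s (filter (\<lambda>x. x \<noteq> v) \<sigma>)"
      using proper_subseq_delete dist \<pi>(2) by metis
    have "nonmax s \<le> nonmax (filter (\<lambda>x. x \<noteq> v) \<sigma>)"
      using v dist by (intro nonmax_subseq) auto
    then have "nonmax \<pi> < nonmax \<sigma>"
      using del[OF v(1)] nonmax_order_iso[OF \<pi>(3)] by simp
    then show ?thesis using C_iff[OF \<pi>(1)] by simp
  qed
  moreover have "\<sigma> \<notin> C (nonmax \<sigma> - 1)" using C_iff[OF perm] pos by simp
  ultimately show "\<sigma> \<in> basis_perms n"
    using len perm unfolding basis_perms_def B_def by blast
qed

section \<open>The generating polynomial\<close>

text \<open>Once a maximum \<open>v\<close> is superseded by a larger one, every later entry below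
  \<open>v\<close> has two larger predecessors, so \<open>v\<close> can no longer become a sole
  dominator. A prefix that can still be completed thus lacks at most its current largest entry among
  the sole dominators: it is closed or open.\<close>

definition closed_state :: "nat list \<Rightarrow> bool" where
  "closed_state xs \<longleftrightarrow> lrm xs \<subseteq> sole_dominators xs"

text \<open>\<open>Max {}\<close> is unspecified; nonemptiness keeps the empty list from counting as
  open as well as closed.\<close>

definition open_state :: "nat list \<Rightarrow> bool" where
  "open_state xs \<longleftrightarrow>
     xs \<noteq> [] \<and> lrm xs - {Max (set xs)} \<subseteq> sole_dominators xs \<and> Max (set xs) \<notin> sole_dominators xs"

lemma Max_in_lrm:
  assumes "distinct xs" "xs \<noteq> []"
  shows "Max (set xs) \<in> lrm xs"
  using assms
proof (induction xs rule: rev_induct)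
  case (snoc x xs)
  show ?case
  proof (cases "xs = []")
    case True
    then show ?thesis by (simp add: lrm_single)
  next
    case False
    define m where "m = Max (set xs)"
    have "m \<in> set xs" using False by (simp add: m_def)
    then have "m \<noteq> x" using snoc.prems by auto
    moreover have "(\<forall>y\<in>set xs. y < x) \<longleftrightarrow> m < x" using False by (simp add: m_def)
    moreover have "Max (set (xs @ [x])) = max x m" using False by (simp add: m_def)
    moreover have "m \<in> lrm xs" using snoc False by (simp add: m_def)
    ultimately show ?thesis by (auto simp: lrm_snoc max_def simp del: set_append)
  qed
qed simp

lemma not_closed_and_open: "distinct xs \<Longrightarrow> \<not> (closed_state xs \<and> open_state xs)"
  using Max_in_lrm by (auto simp: closed_state_def open_state_def)

context
  fixes xs :: "nat list" and x :: nat
  assumes dist: "distinct (xs @ [x])"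
begin

text \<open>The new maximum has no later entry yet and hence is not a sole dominator, while any
  older maximum that is not one by now never will be.\<close>

lemma snoc_max:
  assumes "\<forall>y\<in>set xs. y < x"
  shows "\<not> closed_state (xs @ [x])" "open_state (xs @ [x]) \<longleftrightarrow> closed_state xs"
    "card (lrm (xs @ [x])) = Suc (card (lrm xs))"
proof -
  have x: "x \<notin> set xs" using dist by simp
  then have notin: "x \<notin> lrm xs" "x \<notin> sole_dominators xs" using lrm_subset sole_dominators_subset by blast+
  have l: "lrm (xs @ [x]) = insert x (lrm xs)" using assms by (simp add: lrm_snoc)
  have "{z \<in> set xs. x < z} = {}" using assms by auto
  then have s: "sole_dominators (xs @ [x]) = sole_dominators xs" by (auto simp only: sole_dominators_snoc)
  have m: "Max (set (xs @ [x])) = x"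
    by (rule Max_eqI) (use assms in \<open>auto intro: less_imp_le\<close>)
  show "\<not> closed_state (xs @ [x])" using l s notin by (auto simp: closed_state_def)
  show "open_state (xs @ [x]) \<longleftrightarrow> closed_state xs"
    unfolding open_state_def closed_state_def m l s using notin by auto
  show "card (lrm (xs @ [x])) = Suc (card (lrm xs))"
    using l notin by simp
qed

context
  assumes notmax: "\<exists>y\<in>set xs. x < y"
begin

lemma lrm_snoc_not_max: "lrm (xs @ [x]) = lrm xs"
  using notmax by (auto simp: lrm_snoc)

lemma Max_snoc_not_max: "Max (set (xs @ [x])) = Max (set xs)"
proof -
  obtain y where "y \<in> set xs" "x < y" using notmax by blast
  then have "x < Max (set xs)" by (meson List.finite_set Max_ge less_le_trans)
  moreover have "xs \<noteq> []" using notmax by auto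
  ultimately show ?thesis by simp
qed

text \<open>Here \<open>x\<close> is the second largest entry, so \<open>v\<close> is the largest
  one. It becomes a sole dominator, which is just what an open prefix was lacking.\<close>

lemma snoc_second:
  assumes "{z \<in> set xs. x < z} = {v}"
  shows "closed_state (xs @ [x]) \<longleftrightarrow> closed_state xs \<or> open_state xs"
    "\<not> open_state (xs @ [x])"
proof -
  have v: "v \<in> set xs" "x < v" using assms by auto
  have "y \<le> v" if "y \<in> set xs" for y
    using assms that v by (metis (mono_tags, lifting) le_less less_trans mem_Collect_eq not_le singletonD)
  then have m: "Max (set xs) = v" using v by (intro Max_eqI) auto
  have s: "sole_dominators (xs @ [x]) = insert v (sole_dominators xs)"
    using assms by (auto simp: sole_dominators_snoc)
  show "closed_state (xs @ [x]) \<longleftrightarrow> closed_state xs \<or> open_state xs"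
    unfolding closed_state_def open_state_def s lrm_snoc_not_max m using v by auto
  show "\<not> open_state (xs @ [x])"
    unfolding open_state_def Max_snoc_not_max s m by simp
qed

text \<open>With at least two larger predecessors, \<open>x\<close> changes neither the
  left-to-right maxima nor the sole dominators.\<close>

lemma snoc_other:
  assumes "\<nexists>v. {z \<in> set xs. x < z} = {v}"
  shows "closed_state (xs @ [x]) \<longleftrightarrow> closed_state xs"
    "open_state (xs @ [x]) \<longleftrightarrow> open_state xs"
proof -
  have s: "sole_dominators (xs @ [x]) = sole_dominators xs"
    using assms by (auto simp: sole_dominators_snoc)
  show "closed_state (xs @ [x]) \<longleftrightarrow> closed_state xs"
    by (simp only: closed_state_def s lrm_snoc_not_max)
  have "xs \<noteq> []" using notmax by auto
  then show "open_state (xs @ [x]) \<longleftrightarrow> open_state xs"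
    by (simp only: open_state_def Max_snoc_not_max s lrm_snoc_not_max) simp
qed

end

end

section \<open>The linear recursion and its solution\<close>

lemma sum_permutations_of_set_snoc:
  fixes f :: "'a list \<Rightarrow> 'b::comm_monoid_add"
  assumes "finite S" "S \<noteq> {}"
  shows "(\<Sum>xs\<in>permutations_of_set S. f xs) =
           (\<Sum>x\<in>S. \<Sum>xs\<in>permutations_of_set (S - {x}). f (xs @ [x]))"
proof -
  have eq: "permutations_of_set S = (\<Union>x\<in>S. (\<lambda>xs. xs @ [x]) ` permutations_of_set (S - {x}))"
  proof (intro set_eqI iffI)
    fix xs assume xs: "xs \<in> permutations_of_set S"
    then have "xs \<noteq> []" using assms(2) by (auto simp: permutations_of_set_def)
    then obtain ys y where "xs = ys @ [y]" by (metis rev_exhaust)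
    then show "xs \<in> (\<Union>x\<in>S. (\<lambda>xs. xs @ [x]) ` permutations_of_set (S - {x}))"
      using xs by (auto simp: permutations_of_set_def)
  next
    fix xs assume "xs \<in> (\<Union>x\<in>S. (\<lambda>xs. xs @ [x]) ` permutations_of_set (S - {x}))"
    then obtain x ys where "x \<in> S" "xs = ys @ [x]" "set ys = S - {x}" "distinct ys"
      by (elim UN_E imageE) (auto dest: permutations_of_setD)
    then show "xs \<in> permutations_of_set S" by (intro permutations_of_setI) auto
  qed
  have "(\<Sum>xs\<in>permutations_of_set S. f xs) =
      (\<Sum>x\<in>S. \<Sum>xs\<in>(\<lambda>xs. xs @ [x]) ` permutations_of_set (S - {x}). f xs)"
    by (subst eq, rule sum.UNION_disjoint) (use assms(1) in auto)
  also have "\<dots> = (\<Sum>x\<in>S. \<Sum>xs\<in>permutations_of_set (S - {x}). f (xs @ [x]))"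
    by (rule sum.cong[OF refl], subst sum.reindex) (auto simp: inj_on_def)
  finally show ?thesis .
qed

text \<open>Arbitrary finite value sets are allowed because removing the last entry of a permutation
  of \<open>{0..<n}\<close> leaves a set with a gap.\<close>

definition lrm_sum :: "(nat list \<Rightarrow> bool) \<Rightarrow> complex \<Rightarrow> nat set \<Rightarrow> complex" where
  "lrm_sum P u S = (\<Sum>xs\<in>permutations_of_set S. if P xs then u ^ card (lrm xs) else 0)"

text \<open>The recursion appends an entry to \<open>m\<close> others, by its rank: the largest
  turns closed into open with weight \<open>u\<close>, the second largest closes both states, and
  the \<open>m - 1\<close> smaller ranks change nothing. The coefficient \<open>of_nat m - 1\<close>
  is \<open>-1\<close> at \<open>m = 0\<close>, but there it multiplies
  \<open>open_poly u 0 = 0\<close>.\<close>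

fun open_poly closed_poly :: "complex \<Rightarrow> nat \<Rightarrow> complex" where
  "open_poly u 0 = 0"
| "closed_poly u 0 = 1"
| "open_poly u (Suc m) = (of_nat m - 1) * open_poly u m + u * closed_poly u m"
| "closed_poly u (Suc m) = open_poly u m + of_nat m * closed_poly u m"

lemma lrm_sum_snoc:
  assumes "finite S" "S \<noteq> {}"
  shows "lrm_sum P u S = (\<Sum>x\<in>S. \<Sum>xs\<in>permutations_of_set (S - {x}).
           if P (xs @ [x]) then u ^ card (lrm (xs @ [x])) else 0)"
  unfolding lrm_sum_def by (rule sum_permutations_of_set_snoc[OF assms])

lemma lrm_sum_poly:
  "finite S \<Longrightarrow> card S = m \<Longrightarrow>
     lrm_sum open_state u S = open_poly u m \<and> lrm_sum closed_state u S = closed_poly u m"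
proof (induction m arbitrary: S)
  case 0
  then show ?case by (simp add: lrm_sum_def open_state_def closed_state_def)
next
  case (Suc m)
  define tsum where "tsum = (\<lambda>P x. \<Sum>xs\<in>permutations_of_set (S - {x}).
           if P (xs @ [x]) then u ^ card (lrm (xs @ [x])) else 0)"
  have ne: "S \<noteq> {}" using Suc.prems by auto
  have sum: "lrm_sum P u S = (\<Sum>x\<in>S. tsum P x)" for P
    unfolding tsum_def by (rule lrm_sum_snoc[OF Suc.prems(1) ne])
  have IH: "lrm_sum open_state u (S - {x}) = open_poly u m"
    "lrm_sum closed_state u (S - {x}) = closed_poly u m" if "x \<in> S" for x
    using Suc.IH[of "S - {x}"] Suc.prems that by simp_all
  have perm: "distinct (xs @ [x])" "set xs = S - {x}"
    if "x \<in> S" "xs \<in> permutations_of_set (S - {x})" for x xs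
    using that by (auto simp: permutations_of_set_def)
  define M where "M = Max S"
  have M: "M \<in> S" "\<And>y. y \<in> S \<Longrightarrow> y \<le> M"
    unfolding M_def using Suc.prems ne by (auto intro: Max_in)
  have top: "tsum closed_state M = 0" "tsum open_state M = u * closed_poly u m"
  proof -
    have lt: "\<forall>y\<in>set xs. y < M" if "xs \<in> permutations_of_set (S - {M})" for xs
      using perm[OF M(1) that] M(2) by (auto simp: less_le)
    have "tsum closed_state M = (\<Sum>xs\<in>permutations_of_set (S - {M}). 0)"
      unfolding tsum_def
      by (rule sum.cong[OF refl]) (simp add: snoc_max(1)[OF perm(1)[OF M(1)] lt])
    then show "tsum closed_state M = 0" by simp
    have "tsum open_state M =
        (\<Sum>xs\<in>permutations_of_set (S - {M}). u * (if closed_state xs then u ^ card (lrm xs) else 0))"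
      unfolding tsum_def
      by (rule sum.cong[OF refl])
        (simp add: snoc_max(2)[OF perm(1)[OF M(1)] lt] snoc_max(3)[OF perm(1)[OF M(1)] lt])
    also have "\<dots> = u * lrm_sum closed_state u (S - {M})"
      by (simp add: lrm_sum_def sum_distrib_left)
    finally show "tsum open_state M = u * closed_poly u m" using IH(2)[OF M(1)] by simp
  qed
  show ?case
  proof (cases m)
    \<comment> \<open>With a single value there is no second largest one, and \<open>top\<close>
      alone gives both sums.\<close>
    case 0
    then have "S = {M}" using Suc.prems M(1) by (metis One_nat_def card_1_singletonE singletonD)
    then show ?thesis unfolding sum using top 0 by (simp add: sum)
  next
    case (Suc k)
    define N where "N = Max (S - {M})"
    have "card (S - {M}) = m" using Suc.prems M(1) \<open>card S = Suc m\<close> by simp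
    then have ne': "S - {M} \<noteq> {}" using Suc by (metis card.empty nat.distinct(1))
    have N: "N \<in> S" "N \<noteq> M" "\<And>y. y \<in> S \<Longrightarrow> y \<noteq> M \<Longrightarrow> y \<le> N"
      using Max_in[OF _ ne'] \<open>finite S\<close> unfolding N_def by auto
    then have NM: "N < M" using M(2) by (meson le_neq_implies_less)
    \<comment> \<open>The values below the two largest; there are \<open>k = m - 1\<close> of
      them.\<close>
    define R where "R = S - {M} - {N}"
    have S: "S = insert M (insert N R)" "M \<notin> insert N R" "N \<notin> R"
      using M(1) N(1,2) by (auto simp: R_def)
    have finR: "finite R" using \<open>finite S\<close> by (simp add: R_def)
    have cardR: "card R = k"
      using \<open>card S = Suc m\<close> Suc S finR by simp
    have second: "tsum closed_state N = open_poly u m + closed_poly u m" "tsum open_state N = 0"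
    proof -
      have gt: "{z \<in> set xs. N < z} = {M}" if "xs \<in> permutations_of_set (S - {N})" for xs
        using perm[OF N(1) that] NM M(1) N(3) by (auto simp: not_le) (meson leD)
      have ex: "\<exists>y\<in>set xs. N < y" if "xs \<in> permutations_of_set (S - {N})" for xs
        using gt[OF that] by blast
      have "tsum open_state N = (\<Sum>xs\<in>permutations_of_set (S - {N}). 0)"
        unfolding tsum_def
        by (rule sum.cong[OF refl]) (simp add: snoc_second(2)[OF perm(1)[OF N(1)] ex gt])
      then show "tsum open_state N = 0" by simp
      have "tsum closed_state N = (\<Sum>xs\<in>permutations_of_set (S - {N}).
          (if open_state xs then u ^ card (lrm xs) else 0) +
          (if closed_state xs then u ^ card (lrm xs) else 0))"
        unfolding tsum_def
      proof (rule sum.cong[OF refl])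
        fix xs assume xs: "xs \<in> permutations_of_set (S - {N})"
        \<comment> \<open>The two states exclude each other, so the weight of their disjunction is
          the sum of the two weights.\<close>
        have "\<not> (closed_state xs \<and> open_state xs)"
          using perm(1)[OF N(1) xs] not_closed_and_open by simp
        then show "(if closed_state (xs @ [N]) then u ^ card (lrm (xs @ [N])) else 0) =
          (if open_state xs then u ^ card (lrm xs) else 0) +
          (if closed_state xs then u ^ card (lrm xs) else 0)"
          using snoc_second(1)[OF perm(1)[OF N(1) xs] ex[OF xs] gt[OF xs]]
            lrm_snoc_not_max[OF perm(1)[OF N(1) xs] ex[OF xs]] by simp
      qed
      then show "tsum closed_state N = open_poly u m + closed_poly u m"
        using IH[OF N(1)] by (simp add: sum.distrib lrm_sum_def)
    qed
    have rest: "tsum closed_state x = closed_poly u m" "tsum open_state x = open_poly u m"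
      if x: "x \<in> R" for x
    proof -
      have xS: "x \<in> S" "x \<noteq> M" "x \<noteq> N" using x by (auto simp: R_def)
      then have xN: "x < N" "x < M" using N(3) M(2) by (auto simp: less_le)
      have ex: "\<exists>y\<in>set xs. x < y" if "xs \<in> permutations_of_set (S - {x})" for xs
        using perm(2)[OF xS(1) that] xN M(1) by auto
      have no: "\<nexists>v. {z \<in> set xs. x < z} = {v}" if "xs \<in> permutations_of_set (S - {x})" for xs
      proof
        assume "\<exists>v. {z \<in> set xs. x < z} = {v}"
        then obtain v where v: "{z \<in> set xs. x < z} = {v}" ..
        have "{N, M} \<subseteq> {z \<in> set xs. x < z}"
          using perm(2)[OF xS(1) that] xN M(1) N(1) by auto
        then show False using v N(2) by auto
      qed
      have "tsum closed_state x = lrm_sum closed_state u (S - {x})"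
        unfolding tsum_def lrm_sum_def
        by (rule sum.cong[OF refl])
          (simp add: snoc_other(1)[OF perm(1)[OF xS(1)] ex no] lrm_snoc_not_max[OF perm(1)[OF xS(1)] ex])
      then show "tsum closed_state x = closed_poly u m" using IH(2)[OF xS(1)] by simp
      have "tsum open_state x = lrm_sum open_state u (S - {x})"
        unfolding tsum_def lrm_sum_def
        by (rule sum.cong[OF refl])
          (simp add: snoc_other(2)[OF perm(1)[OF xS(1)] ex no] lrm_snoc_not_max[OF perm(1)[OF xS(1)] ex])
      then show "tsum open_state x = open_poly u m" using IH(1)[OF xS(1)] by simp
    qed
    have split: "(\<Sum>x\<in>S. tsum P x) = tsum P M + (tsum P N + (\<Sum>x\<in>R. tsum P x))" for P
      using S finR by simp
    have "(\<Sum>x\<in>R. tsum closed_state x) = of_nat k * closed_poly u m"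
      "(\<Sum>x\<in>R. tsum open_state x) = of_nat k * open_poly u m"
      using rest cardR by simp_all
    then show ?thesis
      unfolding sum split top second using Suc by (simp add: algebra_simps)
  qed
qed

text \<open>The transfer matrix of the recursion is diagonalised by putting \<open>u = x (x + 1)\<close>:
  its step from \<open>m\<close> to \<open>m + 1\<close> then has the eigenvalues \<open>m + x\<close> and \<open>m - 1 - x\<close>.\<close>

lemma closed_poly_eq:
  fixes x :: complex
  assumes "u = x * (x + 1)"
  shows "(1 + 2 * x) * closed_poly u m = (x + 1) * pochhammer x m + x * pochhammer (- 1 - x) m"
proof -
  \<comment> \<open>The left eigenvectors \<open>(1, x + 1)\<close> and \<open>(1, - x)\<close> are
    the same for every \<open>m\<close>, so iterating the recursion multiplies the eigenvalues into
    rising factorials.\<close>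
  have 1: "open_poly u m + (x + 1) * closed_poly u m = (x + 1) * pochhammer x m"
  proof (induction m)
    case (Suc m)
    have "open_poly u (Suc m) + (x + 1) * closed_poly u (Suc m) =
        (x + of_nat m) * (open_poly u m + (x + 1) * closed_poly u m)"
      by (simp add: assms algebra_simps)
    then show ?case using Suc by (simp add: pochhammer_Suc)
  qed simp
  have 2: "open_poly u m - x * closed_poly u m = - x * pochhammer (- 1 - x) m"
  proof (induction m)
    case (Suc m)
    have "open_poly u (Suc m) - x * closed_poly u (Suc m) =
        (- 1 - x + of_nat m) * (open_poly u m - x * closed_poly u m)"
      by (simp add: assms algebra_simps)
    then show ?case using Suc by (simp add: pochhammer_Suc)
  qed simp
  have "(1 + 2 * x) * closed_poly u m =
      (open_poly u m + (x + 1) * closed_poly u m) - (open_poly u m - x * closed_poly u m)"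
    by (simp add: algebra_simps)
  then show ?thesis unfolding 1 2 by simp
qed

lemma finite_basis_perms: "finite (basis_perms n)"
proof -
  have "basis_perms n \<subseteq> permutations_of_set {0..<n}"
    by (auto simp: basis_perms_iff is_perm_def permutations_of_set_def)
  then show ?thesis by (rule finite_subset) simp
qed

text \<open>For \<open>n = 0\<close> this fails: the empty list is closed, so
  \<open>closed_poly u 0 = 1\<close>, but it is not in the basis.\<close>

lemma sum_basis_perms:
  assumes "n > 0"
  shows "(\<Sum>\<sigma>\<in>basis_perms n. u ^ num_ltr_max \<sigma>) = closed_poly u n"
proof -
  have "basis_perms n = {xs \<in> permutations_of_set {0..<n}. closed_state xs}"
  proof (intro set_eqI iffI)
    fix xs assume "xs \<in> {xs \<in> permutations_of_set {0..<n}. closed_state xs}"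
    then have xs: "xs \<in> permutations_of_set {0..<n}" "closed_state xs" by auto
    then have "length xs = n" using length_finite_permutations_of_set by fastforce
    then show "xs \<in> basis_perms n"
      using xs assms permutations_of_setD[OF xs(1)]
      by (auto simp: basis_perms_iff is_perm_def closed_state_def)
  qed (auto simp: basis_perms_iff is_perm_def closed_state_def)
  then have "(\<Sum>\<sigma>\<in>basis_perms n. u ^ num_ltr_max \<sigma>) = lrm_sum closed_state u {0..<n}"
    unfolding lrm_sum_def card_lrm by (simp add: sum.inter_filter)
  then show ?thesis using lrm_sum_poly[of "{0..<n}" n] by simp
qed

section \<open>Asymptotics of the generating polynomial near \<open>u = 1\<close>\<close>

definition golden :: real where
  "golden = (sqrt 5 - 1) / 2"

lemma golden_bounds: "1 / 2 < golden" "golden < 1"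
proof -
  have "2 < sqrt 5" "sqrt 5 < 3" by (auto intro: real_less_rsqrt real_less_lsqrt)
  then show "1 / 2 < golden" "golden < 1" by (simp_all add: golden_def)
qed

text \<open>\<open>1 + 2 * golden\<close> is the derivative of \<open>x * (x + 1)\<close> at
  \<open>golden\<close>; this is the origin of the factor \<open>sqrt 5\<close> in the mean.\<close>

lemma golden_eqs: "1 + 2 * golden = sqrt 5" "golden * (golden + 1) = 1"
  by (simp_all add: golden_def field_simps)

lemma golden_eqs_complex:
  "1 + 2 * complex_of_real golden = of_real (sqrt 5)"
  "complex_of_real golden * (of_real golden + 1) = 1"
proof -
  have "1 + 2 * complex_of_real golden = of_real (1 + 2 * golden)" by simp
  then show "1 + 2 * complex_of_real golden = of_real (sqrt 5)" by (simp only: golden_eqs)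
  have "complex_of_real golden * (of_real golden + 1) = of_real (golden * (golden + 1))" by simp
  then show "complex_of_real golden * (of_real golden + 1) = 1" by (simp only: golden_eqs of_real_1)
qed

text \<open>The logarithmic derivative of \<open>pochhammer x n\<close> at
  \<open>x = golden\<close>.\<close>

definition shifted_harm :: "nat \<Rightarrow> real" where
  "shifted_harm n = (\<Sum>i<n. 1 / (golden + real i))"

text \<open>Since \<open>golden\<close> lies between \<open>1 / 2\<close> and \<open>1\<close>, the
  first term is at most 2 and the term with index \<open>i > 0\<close> lies between
  \<open>1 / (i + 1)\<close> and \<open>1 / i\<close>. The difference \<open>harm n - ln n\<close>
  contributes at most 1 more.\<close>

lemma shifted_harm_ln:
  assumes "n > 0"
  shows "\<bar>shifted_harm n - ln (real n)\<bar> \<le> 3"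
proof -
  have "harm n \<le> shifted_harm n"
    unfolding harm_altdef shifted_harm_def using golden_bounds
    by (intro sum_mono) (simp add: field_simps)
  moreover have "shifted_harm (Suc m) \<le> 2 + harm m" for m
  proof (induction m)
    case 0
    show ?case using golden_bounds by (simp add: shifted_harm_def harm_def field_simps)
  next
    case (Suc m)
    have "1 / (golden + real (Suc m)) \<le> inverse (real (Suc m))"
      using golden_bounds by (simp add: field_simps)
    then show ?case using Suc by (simp add: shifted_harm_def harm_Suc)
  qed
  then have "shifted_harm n \<le> 2 + harm n"
    using assms harm_mono[of "n - 1" n] by (metis Suc_diff_1 add_left_mono diff_le_self order_trans)
  moreover have "ln (real n) \<le> harm n"
    using harm_ge_ln[of n] assms by (smt (verit) ln_less_cancel_iff of_nat_0_less_iff)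
  moreover have "harm n - ln (real n) \<le> 1"
  proof -
    obtain m where m: "n = Suc m" using assms by (cases n) auto
    have "harm (Suc m) - ln (real (Suc m)) \<le> harm (Suc 0) - ln (real (Suc 0))"
      by (rule decseqD[OF decseq_harm_diff_ln le0])
    then show ?thesis using m by (simp add: harm_def)
  qed
  ultimately show ?thesis by linarith
qed

lemma shifted_harm_at_top: "filterlim shifted_harm at_top sequentially"
proof (rule filterlim_at_top_mono)
  show "filterlim (\<lambda>n. ln (real n) - 3) at_top sequentially" by real_asymp
  show "\<forall>\<^sub>F n in sequentially. ln (real n) - 3 \<le> shifted_harm n"
    using eventually_gt_at_top[of 0]
  proof eventually_elim
    case (elim n)
    then show ?case using shifted_harm_ln[of n] by linarith
  qed
qed

section \<open>Growth of rising factorials and the uniform bound\<close>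

text \<open>\<open>1 + t \<le> exp t\<close> is applied to the squared norm. Unlike the bound by
  \<open>exp (norm z)\<close>, this keeps the exact first-order term \<open>Re z\<close>.\<close>

lemma norm_one_plus_le: "norm (1 + z) \<le> exp (Re z + (norm z)\<^sup>2 / 2)"
proof (rule power2_le_imp_le)
  have "(norm (1 + z))\<^sup>2 = 1 + (2 * Re z + (norm z)\<^sup>2)"
    unfolding cmod_power2 by (simp add: power2_eq_square algebra_simps)
  also have "\<dots> \<le> exp (2 * Re z + (norm z)\<^sup>2)" by (rule exp_ge_add_one_self)
  also have "\<dots> = (exp (Re z + (norm z)\<^sup>2 / 2))\<^sup>2"
    by (simp add: power2_eq_square flip: exp_add)
  finally show "(norm (1 + z))\<^sup>2 \<le> (exp (Re z + (norm z)\<^sup>2 / 2))\<^sup>2" .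
qed simp

text \<open>The first term is at most 4 because \<open>golden > 1 / 2\<close>; the term with index
  \<open>i > 0\<close> is at most \<open>4 / (i (i + 1))\<close>, and these telescope to less than
  4.\<close>

lemma sum_inverse_squares_le: "(\<Sum>i<n. 1 / (golden + real i)\<^sup>2) \<le> 8"
proof -
  have "(\<Sum>i<Suc m. 1 / (golden + real i)\<^sup>2) \<le> 8 - 4 / (real m + 1)" for m
  proof (induction m)
    case 0
    have "(1 / 2)\<^sup>2 \<le> golden\<^sup>2" using golden_bounds by (intro power_mono) auto
    then show ?case using golden_bounds by (simp add: field_simps)
  next
    case (Suc m)
    have "(real m + 1) * (real m + 2) \<le> 4 * (golden + real (Suc m))\<^sup>2"
    proof -
      have "(real m + 1) * (real m + 2) \<le> 4 * (1/2 + real (Suc m))\<^sup>2"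
        by (simp add: power2_eq_square algebra_simps)
      also have "\<dots> \<le> 4 * (golden + real (Suc m))\<^sup>2"
        using golden_bounds by (intro mult_left_mono power_mono) auto
      finally show ?thesis .
    qed
    moreover have "golden + real (Suc m) > 0" using golden_bounds by simp
    ultimately have "4 / (4 * (golden + real (Suc m))\<^sup>2) \<le> 4 / ((real m + 1) * (real m + 2))"
      by (intro divide_left_mono) auto
    then have "1 / (golden + real (Suc m))\<^sup>2 \<le> 4 / ((real m + 1) * (real m + 2))"
      by simp
    also have "\<dots> = 4 / (real m + 1) - 4 / (real (Suc m) + 1)"
      by (simp add: field_simps)
    finally show ?case using Suc by simp
  qed
  from this[of n] have "(\<Sum>i<Suc n. 1 / (golden + real i)\<^sup>2) \<le> 8"
    by (smt (verit) divide_nonneg_nonneg of_nat_0_le_iff)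
  moreover have "0 \<le> 1 / (golden + real n)\<^sup>2" by simp
  ultimately show ?thesis unfolding sum.lessThan_Suc by linarith
qed

text \<open>Each factor is \<open>(golden + i) (1 + z)\<close> with
  \<open>z = (y - golden) / (golden + i)\<close>. By \<open>norm_one_plus_le\<close> the first-order
  terms add up to the multiple of \<open>shifted_harm n\<close>, and the second-order ones to at
  most \<open>8 / 2 = 4\<close> times the squared distance. No restriction on \<open>y\<close> is
  made, so that \<open>y = - 1 - x\<close> is covered too.\<close>

lemma norm_pochhammer_le:
  fixes y :: complex
  shows "norm (pochhammer y n) \<le> pochhammer golden n *
     exp ((Re y - golden) * shifted_harm n + 4 * (norm (y - golden))\<^sup>2)"
proof -
  define q where "q = (norm (y - golden))\<^sup>2 / 2"
  have "norm (pochhammer y n) \<le> pochhammer golden n *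
      exp ((Re y - golden) * shifted_harm n + q * (\<Sum>i<n. 1 / (golden + real i)\<^sup>2))"
  proof (induction n)
    case (Suc n)
    define a where "a = golden + real n"
    have a: "a > 0" using golden_bounds by (simp add: a_def)
    define z where "z = (y - golden) / of_real a"
    have eq: "y + of_nat n = of_real a * (1 + z)"
      using a by (simp add: z_def a_def field_simps del: of_real_add) (simp add: algebra_simps)
    have "norm (y + of_nat n) = a * norm (1 + z)"
      unfolding eq using a by (simp add: norm_mult)
    also have "\<dots> \<le> a * exp (Re z + (norm z)\<^sup>2 / 2)"
      using a norm_one_plus_le by (intro mult_left_mono) auto
    also have "Re z = (Re y - golden) * (1 / a)"
      by (simp add: z_def Re_divide_of_real)
    also have "(norm z)\<^sup>2 / 2 = q * (1 / a\<^sup>2)"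
      using a by (simp add: z_def q_def norm_divide power_divide)
    finally have 1: "norm (y + of_nat n) \<le> a * exp ((Re y - golden) * (1 / a) + q * (1 / a\<^sup>2))" .
    have "norm (pochhammer y (Suc n)) = norm (pochhammer y n) * norm (y + of_nat n)"
      by (simp add: pochhammer_Suc norm_mult)
    also have "\<dots> \<le> (pochhammer golden n *
        exp ((Re y - golden) * shifted_harm n + q * (\<Sum>i<n. 1 / (golden + real i)\<^sup>2))) *
        (a * exp ((Re y - golden) * (1 / a) + q * (1 / a\<^sup>2)))"
      using golden_bounds by (intro mult_mono Suc 1) (auto intro!: mult_nonneg_nonneg pochhammer_nonneg)
    also have "\<dots> = (pochhammer golden n * a) *
        (exp ((Re y - golden) * shifted_harm n + q * (\<Sum>i<n. 1 / (golden + real i)\<^sup>2)) *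
         exp ((Re y - golden) * (1 / a) + q * (1 / a\<^sup>2)))"
      by (simp only: ac_simps)
    also have "\<dots> = pochhammer golden (Suc n) *
        exp ((Re y - golden) * shifted_harm (Suc n) + q * (\<Sum>i<Suc n. 1 / (golden + real i)\<^sup>2))"
      unfolding exp_add[symmetric]
      by (simp add: pochhammer_Suc shifted_harm_def a_def algebra_simps)
    finally show ?case .
  qed (simp add: shifted_harm_def)
  also have "\<dots> \<le> pochhammer golden n * exp ((Re y - golden) * shifted_harm n + q * 8)"
  proof -
    have "q * (\<Sum>i<n. 1 / (golden + real i)\<^sup>2) \<le> q * 8"
      by (rule mult_left_mono[OF sum_inverse_squares_le]) (simp add: q_def)
    then show ?thesis
      using golden_bounds by (intro mult_left_mono) (auto intro: pochhammer_nonneg)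
  qed
  finally show ?thesis by (simp add: q_def)
qed

text \<open>With \<open>u = x (x + 1)\<close>, this is the generating polynomial divided by its main
  contribution \<open>pochhammer golden n * exp ((x - golden) * shifted_harm n)\<close>.\<close>

definition normalised :: "nat \<Rightarrow> complex \<Rightarrow> complex" where
  "normalised n x =
     ((x + 1) * pochhammer x n + x * pochhammer (- 1 - x) n) / ((1 + 2 * x) * of_real (pochhammer golden n))
       * exp (- ((x - of_real golden) * of_real (shifted_harm n)))"

lemma pochhammer_golden_pos: "pochhammer golden n > 0"
  using golden_bounds by (intro pochhammer_pos) auto

text \<open>The radius \<open>1 / 2\<close> is less than \<open>golden\<close>, so the disc lies in
  the right half-plane, away from the pole at \<open>- 1 / 2\<close>.\<close>

lemma near_golden:
  assumes "x \<in> cball (complex_of_real golden) (1 / 2)"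
  shows "0 < Re x" "1 + 2 * x \<noteq> 0" "norm (1 + 2 * x) \<ge> 1" "norm x \<le> 2"
proof -
  have d: "norm (x - golden) \<le> 1 / 2" using assms by (simp add: dist_norm norm_minus_commute)
  have "\<bar>Re x - golden\<bar> \<le> 1 / 2" using abs_Re_le_cmod[of "x - golden"] d by simp
  then show r: "0 < Re x" using golden_bounds by linarith
  have "Re (1 + 2 * x) \<ge> 1" using r by simp
  then show "norm (1 + 2 * x) \<ge> 1" using complex_Re_le_cmod order_trans by blast
  then show "1 + 2 * x \<noteq> 0" by force
  have "norm x \<le> norm (x - golden) + norm (complex_of_real golden)"
    by (metis diff_add_cancel norm_triangle_ineq)
  then show "norm x \<le> 2" using d golden_bounds by simp
qed

lemma norm_exp_minus_le:
  "norm (exp (- ((x - complex_of_real golden) * of_real h))) = exp (- ((Re x - golden) * h))"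
  by (simp add: norm_exp_eq_Re)

text \<open>For \<open>pochhammer x n\<close> the exponential factor cancels the growth exactly. For
  \<open>y = - 1 - x\<close> it does more, as \<open>Re y < Re x\<close>, and
  \<open>norm (y - golden) \<le> 4\<close> gives the constant \<open>exp (4 * 16)\<close>. The
  factor 5 bounds \<open>norm (x + 1) + norm x\<close>.\<close>

lemma normalised_bounded:
  assumes x: "x \<in> cball (complex_of_real golden) (1 / 2)"
  shows "norm (normalised n x) \<le> 5 * exp 64"
proof -
  define h where "h = shifted_harm n"
  define p where "p = pochhammer golden n"
  have p: "p > 0" using pochhammer_golden_pos by (simp add: p_def)
  have h: "h \<ge> 0" unfolding h_def shifted_harm_def using golden_bounds by (intro sum_nonneg) simp
  note near = near_golden[OF x]
  have d: "norm (x - golden) \<le> 1 / 2" using x by (simp add: dist_norm norm_minus_commute)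
  define e where "e = exp (- ((Re x - golden) * h))"
  have "norm (pochhammer x n) * e \<le>
      p * exp ((Re x - golden) * h + 4 * (norm (x - golden))\<^sup>2) * e"
    unfolding p_def h_def e_def by (intro mult_right_mono norm_pochhammer_le) simp
  also have "\<dots> = p * exp (4 * (norm (x - golden))\<^sup>2)"
    by (simp add: e_def mult.assoc flip: exp_add)
  also have "\<dots> \<le> p * exp 64"
  proof -
    have "(norm (x - golden))\<^sup>2 \<le> (1 / 2)\<^sup>2" using d by (intro power_mono) auto
    then show ?thesis using p by (simp add: power2_eq_square)
  qed
  finally have 1: "norm (pochhammer x n) * e \<le> p * exp 64" .
  define y where "y = - 1 - x"
  have "norm (pochhammer y n) * e \<le>
      p * exp ((Re y - golden) * h + 4 * (norm (y - golden))\<^sup>2) * e"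
    unfolding p_def h_def e_def by (intro mult_right_mono norm_pochhammer_le) simp
  also have "\<dots> = p * exp ((Re y - Re x) * h + 4 * (norm (y - golden))\<^sup>2)"
    by (simp add: e_def mult.assoc algebra_simps flip: exp_add)
  also have "\<dots> \<le> p * exp 64"
  proof -
    have "y - golden = - (1 + x + golden)" by (simp add: y_def)
    then have "norm (y - golden) = norm (1 + x + golden)" by (metis norm_minus_cancel)
    also have "\<dots> \<le> norm (1 + x) + norm (complex_of_real golden)" by (rule norm_triangle_ineq)
    also have "norm (1 + x) \<le> 1 + norm x" using norm_triangle_ineq[of 1 x] by simp
    finally have "norm (y - golden) \<le> 4" using near(4) golden_bounds by simp
    then have "(norm (y - golden))\<^sup>2 \<le> 4\<^sup>2" by (intro power_mono) auto
    moreover have "(Re y - Re x) * h \<le> 0"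
      using near(1) h by (intro mult_nonpos_nonneg) (auto simp: y_def)
    ultimately show ?thesis using p by simp
  qed
  finally have 2: "norm (pochhammer y n) * e \<le> p * exp 64" .
  have "norm (normalised n x) =
      norm ((x + 1) * pochhammer x n + x * pochhammer y n) * e / (norm (1 + 2 * x) * p)"
    unfolding normalised_def y_def[symmetric] h_def[symmetric] p_def[symmetric] norm_mult norm_divide
      norm_exp_minus_le e_def using p by simp
  also have "\<dots> \<le> norm ((x + 1) * pochhammer x n + x * pochhammer y n) * e / (1 * p)"
    using near(3) p by (intro divide_left_mono mult_right_mono mult_pos_pos) (auto simp: e_def)
  also have "\<dots> \<le> (norm (x + 1) * (norm (pochhammer x n) * e) + norm x * (norm (pochhammer y n) * e)) / p"
    using norm_triangle_ineq[of "(x + 1) * pochhammer x n" "x * pochhammer y n"] p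
    by (simp add: e_def norm_mult divide_right_mono flip: distrib_right mult.assoc)
  also have "\<dots> \<le> (3 * (p * exp 64) + 2 * (p * exp 64)) / p"
  proof -
    have "norm (x + 1) \<le> 3" using norm_triangle_ineq[of x 1] near(4) by simp
    then have "norm (x + 1) * (norm (pochhammer x n) * e) \<le> 3 * (p * exp 64)"
      by (rule mult_mono) (use 1 in \<open>auto simp: e_def\<close>)
    moreover have "norm x * (norm (pochhammer y n) * e) \<le> 2 * (p * exp 64)"
      using near(4) by (rule mult_mono) (use 2 in \<open>auto simp: e_def\<close>)
    ultimately show ?thesis using p by (intro divide_right_mono add_mono) auto
  qed
  also have "\<dots> = 5 * exp 64" using p by simp
  finally show ?thesis .
qed

text \<open>At \<open>golden\<close> the first rising factorial contributes the limit exactly and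
  the second decays like \<open>exp (- sqrt 5 * shifted_harm n)\<close>. The limit is nonzero, which
  permits division by \<open>normalised n golden\<close> for large \<open>n\<close>.\<close>

lemma normalised_golden_tendsto:
  "(\<lambda>n. normalised n (of_real golden)) \<longlonglongrightarrow> of_real ((golden + 1) / sqrt 5)"
proof -
  let ?g = "complex_of_real golden"
  define r where "r = (\<lambda>n. ?g * pochhammer (- 1 - ?g) n / (of_real (sqrt 5) * of_real (pochhammer golden n)))"
  have eq: "normalised n ?g = of_real ((golden + 1) / sqrt 5) + r n" for n
    using pochhammer_golden_pos[of n]
    unfolding normalised_def golden_eqs_complex r_def
    by (simp add: add_divide_distrib pochhammer_of_real)
  have "r \<longlonglongrightarrow> 0"
  proof (rule Lim_null_comparison)
    show "(\<lambda>n. exp (- (1 + 2 * golden) * shifted_harm n + 64)) \<longlonglongrightarrow> 0"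
    proof -
      have "filterlim (\<lambda>n. (1 + 2 * golden) * shifted_harm n) at_top sequentially"
        using golden_bounds
        by (intro filterlim_tendsto_pos_mult_at_top[OF tendsto_const _ shifted_harm_at_top]) auto
      then have "filterlim (\<lambda>n. - ((1 + 2 * golden) * shifted_harm n)) at_bot sequentially"
        by (simp add: filterlim_uminus_at_top)
      then have "(\<lambda>n. exp (- ((1 + 2 * golden) * shifted_harm n)) * exp 64) \<longlonglongrightarrow> 0 * exp 64"
        by (intro tendsto_intros filterlim_compose[OF exp_at_bot])
      then show ?thesis by (simp only: exp_add minus_mult_left mult_zero_left)
    qed
    show "\<forall>\<^sub>F n in sequentially. norm (r n) \<le> exp (- (1 + 2 * golden) * shifted_harm n + 64)"
    proof (intro always_eventually allI)
      fix n
      define p where "p = pochhammer golden n"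
      have p: "p > 0" using pochhammer_golden_pos by (simp add: p_def)
      have "norm (pochhammer (- 1 - ?g) n) \<le>
          p * exp ((Re (- 1 - ?g) - golden) * shifted_harm n + 4 * (norm (- 1 - ?g - ?g))\<^sup>2)"
        unfolding p_def by (rule norm_pochhammer_le)
      also have "norm (- 1 - ?g - ?g) = 1 + 2 * golden"
      proof -
        have "- 1 - ?g - ?g = of_real (- (1 + 2 * golden))" by simp
        then show ?thesis using golden_bounds by (simp only: norm_of_real)
      qed
      also have "4 * (1 + 2 * golden)\<^sup>2 = 20" by (simp add: golden_eqs)
      also have "Re (- 1 - ?g) - golden = - (1 + 2 * golden)" by simp
      finally have 1: "norm (pochhammer (- 1 - ?g) n) \<le> p * exp (- (1 + 2 * golden) * shifted_harm n + 20)" .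
      have "sqrt 5 \<ge> 1" by simp
      then have "golden \<le> sqrt 5" using golden_bounds by linarith
      have "norm (r n) = golden / sqrt 5 * (norm (pochhammer (- 1 - ?g) n) / p)"
        using golden_bounds p by (simp add: r_def norm_mult norm_divide p_def[symmetric])
      also have "\<dots> \<le> 1 * exp (- (1 + 2 * golden) * shifted_harm n + 20)"
        using golden_bounds \<open>golden \<le> sqrt 5\<close> 1 p by (intro mult_mono) (auto simp: field_simps)
      also have "\<dots> \<le> exp (- (1 + 2 * golden) * shifted_harm n + 64)" by simp
      finally show "norm (r n) \<le> exp (- (1 + 2 * golden) * shifted_harm n + 64)" .
    qed
  qed
  then have "(\<lambda>n. of_real ((golden + 1) / sqrt 5) + r n) \<longlonglongrightarrow> of_real ((golden + 1) / sqrt 5) + 0"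
    by (intro tendsto_intros)
  then show ?thesis unfolding eq by simp
qed

section \<open>The bounded factor of the probability generating function\<close>

definition quasi_power :: "nat \<Rightarrow> complex \<Rightarrow> complex" where
  "quasi_power n x = normalised n x / normalised n (of_real golden)"

lemma quasi_power_holomorphic:
  "quasi_power n holomorphic_on cball (of_real golden) (1 / 2)"
  unfolding quasi_power_def normalised_def divide_inverse
  using near_golden(2) pochhammer_golden_pos[of n]
  by (intro holomorphic_intros) auto

text \<open>Circles of radius \<open>1 / 4\<close> about points of the smaller disc stay in the disc
  of radius \<open>1 / 2\<close>, where \<open>quasi_power n\<close> is bounded uniformly. Cauchy's
  inequality then bounds the derivatives, and the first of them gives the Lipschitz
  estimate.\<close>

lemma quasi_power_bounds:
  "\<exists>K. \<forall>\<^sub>F n in sequentially. normalised n (of_real golden) \<noteq> 0 \<and>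
     norm (deriv (quasi_power n) (of_real golden)) \<le> K \<and>
     norm (deriv (deriv (quasi_power n)) (of_real golden)) \<le> K \<and>
     (\<forall>x \<in> cball (of_real golden) (1 / 4). norm (quasi_power n x - 1) \<le> K * norm (x - of_real golden))"
proof -
  let ?g = "complex_of_real golden"
  define l where "l = (golden + 1) / sqrt 5"
  have l: "l > 0" using golden_bounds by (simp add: l_def)
  \<comment> \<open>Eventually \<open>norm (normalised n golden)\<close> exceeds half its limit
    \<open>l\<close>, and then \<open>D\<close> bounds \<open>quasi_power n\<close> on the larger
    disc.\<close>
  define D where "D = 5 * exp 64 / (l / 2)"
  have D: "D \<ge> 0" using l by (simp add: D_def)
  have "(\<lambda>n. norm (normalised n ?g)) \<longlonglongrightarrow> norm (complex_of_real l)"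
    unfolding l_def by (intro tendsto_norm normalised_golden_tendsto)
  moreover have "l / 2 < norm (complex_of_real l)" using l by simp
  ultimately have ev: "\<forall>\<^sub>F n in sequentially. l / 2 < norm (normalised n ?g)"
    by (rule order_tendstoD)
  show ?thesis
  \<comment> \<open>\<open>32 = 2! * 4 ^ 2\<close> comes from Cauchy's inequality for the second
    derivative at radius \<open>1 / 4\<close>; it also dominates the factor 4 for the first.\<close>
  proof (intro exI[of _ "32 * D"], rule eventually_mono[OF ev])
    fix n assume n: "l / 2 < norm (normalised n ?g)"
    let ?k = "quasi_power n"
    have ne: "normalised n ?g \<noteq> 0" using n l by auto
    have bound: "norm (?k x) \<le> D" if "x \<in> cball ?g (1 / 2)" for x
      unfolding quasi_power_def norm_divide D_def
      using normalised_bounded[OF that, of n] n l by (intro frac_le) auto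
    note hol = quasi_power_holomorphic[of n]
    have cauchy: "norm ((deriv ^^ m) ?k z) \<le> fact m * D / (1 / 4) ^ m" if z: "z \<in> cball ?g (1 / 4)" for m z
    proof (rule Cauchy_inequality)
      have sub: "cball z (1 / 4) \<subseteq> cball ?g (1 / 2)"
      proof
        fix w assume "w \<in> cball z (1 / 4)"
        then show "w \<in> cball ?g (1 / 2)"
          using z dist_triangle[of ?g w z] by (simp add: dist_commute)
      qed
      show "?k holomorphic_on ball z (1 / 4)"
        using hol sub ball_subset_cball by (meson holomorphic_on_subset subset_trans)
      show "continuous_on (cball z (1 / 4)) ?k"
        using hol sub by (meson continuous_on_subset holomorphic_on_imp_continuous_on)
      show "norm (?k x) \<le> D" if "norm (z - x) = 1 / 4" for x
      proof -
        have "x \<in> cball z (1 / 4)" using that by (simp add: dist_norm)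
        then show ?thesis using sub bound by blast
      qed
    qed simp
    have d1: "norm (deriv ?k z) \<le> 4 * D" if "z \<in> cball ?g (1 / 4)" for z
      using cauchy[OF that, of 1] by simp
    have d2: "norm (deriv (deriv ?k) ?g) \<le> 32 * D"
      using cauchy[of ?g 2] by (simp add: numeral_2_eq_2 field_simps)
    have "norm (?k x - 1) \<le> 32 * D * norm (x - ?g)" if x: "x \<in> cball ?g (1 / 4)" for x
    proof -
      have "norm (?k x - ?k ?g) \<le> (4 * D) * norm (x - ?g)"
      proof (rule field_differentiable_bound)
        fix z assume z: "z \<in> cball ?g (1 / 4)"
        then have "z \<in> ball ?g (1 / 2)" by simp
        then have "?k field_differentiable (at z)"
          using hol by (meson ball_subset_cball holomorphic_on_imp_differentiable_at
              holomorphic_on_subset open_ball)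
        then show "(?k has_field_derivative deriv ?k z) (at z within cball ?g (1 / 4))"
          by (simp add: DERIV_deriv_iff_field_differentiable has_field_derivative_at_within)
        show "norm (deriv ?k z) \<le> 4 * D" by (rule d1[OF z])
      qed (use x in auto)
      moreover have "?k ?g = 1" using ne by (simp add: quasi_power_def)
      moreover have "(4 * D) * norm (x - ?g) \<le> 32 * D * norm (x - ?g)"
        using D by (intro mult_right_mono) auto
      ultimately show ?thesis by simp
    qed
    then show "normalised n ?g \<noteq> 0 \<and> norm (deriv ?k ?g) \<le> 32 * D \<and>
        norm (deriv (deriv ?k) ?g) \<le> 32 * D \<and>
        (\<forall>x\<in>cball ?g (1 / 4). norm (?k x - 1) \<le> 32 * D * norm (x - ?g))"
      using ne d1[of ?g] d2 D by auto
  qed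
qed

text \<open>The branch of \<open>x (x + 1) = exp (\<i> s)\<close> through \<open>golden\<close>.\<close>

definition branch :: "real \<Rightarrow> complex" where
  "branch s = (csqrt (1 + 4 * exp (\<i> * of_real s)) - 1) / 2"

lemma branch_eq: "branch s * (branch s + 1) = exp (\<i> * of_real s)"
proof -
  have "2 * branch s + 1 = csqrt (1 + 4 * exp (\<i> * of_real s))"
  proof -
    have "2 * ((c - 1) / 2) + 1 = c" for c :: complex by (simp add: field_simps)
    then show ?thesis unfolding branch_def .
  qed
  then have "(2 * branch s + 1)\<^sup>2 = 1 + 4 * exp (\<i> * of_real s)"
    by simp
  then have "4 * (branch s * (branch s + 1)) = 4 * exp (\<i> * of_real s)"
    by (simp add: power2_eq_square algebra_simps)
  then show ?thesis by simp
qed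

lemma branch_tendsto: "(branch \<longlongrightarrow> of_real golden) (at 0)"
proof -
  \<comment> \<open>At \<open>s = 0\<close> the radicand is 5, off the cut of
    \<open>csqrt\<close>.\<close>
  have "isCont (\<lambda>s::real. csqrt (1 + 4 * exp (\<i> * of_real s))) 0"
    by (intro isCont_csqrt' continuous_intros) (auto simp: complex_nonpos_Reals_iff)
  then have "isCont branch 0" unfolding branch_def by (intro continuous_intros) auto
  moreover have "branch 0 = of_real golden"
    by (simp add: branch_def golden_def)
  ultimately show ?thesis by (simp add: isCont_def)
qed

lemma exp_i_expansion:
  "((\<lambda>s. (exp (\<i> * of_real s) - 1 - \<i> * of_real s) / of_real (s\<^sup>2)) \<longlongrightarrow> - 1 / 2) (at (0::real))"
proof (rule LIM_zero_cancel, rule Lim_null_comparison)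
  show "((\<lambda>s. \<bar>s\<bar> / 6) \<longlongrightarrow> 0) (at (0::real))" by (intro tendsto_eq_intros) auto
  have "norm ((exp (\<i> * of_real s) - 1 - \<i> * of_real s) / of_real (s\<^sup>2) - - 1 / 2) \<le> \<bar>s\<bar> / 6"
    if "s \<noteq> 0" for s :: real
  proof -
    have eq: "exp (\<i> * of_real s) - (\<Sum>k\<le>2. (\<i> * of_real s) ^ k / fact k) =
        (exp (\<i> * of_real s) - 1 - \<i> * of_real s) + of_real (s\<^sup>2) / 2"
      by (simp add: numeral_2_eq_2 power2_eq_square algebra_simps)
    have "norm ((exp (\<i> * of_real s) - 1 - \<i> * of_real s) + of_real (s\<^sup>2) / 2) \<le> \<bar>s\<bar> ^ 3 / 6"
      using iexp_approx1[of s 2] unfolding eq by (simp add: fact_numeral numeral_3_eq_3)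
    moreover have "(exp (\<i> * of_real s) - 1 - \<i> * of_real s) / of_real (s\<^sup>2) - - 1 / 2 =
        ((exp (\<i> * of_real s) - 1 - \<i> * of_real s) + of_real (s\<^sup>2) / 2) / of_real (s\<^sup>2)"
      using that by (simp add: add_divide_distrib)
    ultimately show ?thesis
      using that by (simp only: norm_divide norm_of_real)
        (simp add: divide_le_eq power3_eq_cube power2_eq_square abs_mult mult_ac)
  qed
  then show "\<forall>\<^sub>F s in at 0. norm ((exp (\<i> * of_real s) - 1 - \<i> * of_real s) / of_real (s\<^sup>2) - - 1 / 2)
      \<le> \<bar>s\<bar> / 6"
    by (simp add: eventually_at_filter)
qed

text \<open>The increment \<open>d\<close> of the branch satisfies
  \<open>d (sqrt 5 + d) = exp (i s) - 1\<close>. To first order \<open>d\<close> is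
  \<open>i s / sqrt 5\<close>; feeding this back into the square of \<open>d\<close> gives the
  second coefficient \<open>(- 1 / 2 + 1 / 5) / sqrt 5\<close>.\<close>

lemma branch_expansion:
  "((\<lambda>s. (branch s - of_real golden - \<i> * of_real s / of_real (sqrt 5)) / of_real (s\<^sup>2))
      \<longlongrightarrow> of_real (- 3 / (10 * sqrt 5))) (at (0::real))"
proof -
  let ?g = "complex_of_real golden" and ?r = "complex_of_real (sqrt 5)"
  define d where "d = (\<lambda>s. branch s - ?g)"
  define e where "e = (\<lambda>s::real. (exp (\<i> * of_real s) - 1 - \<i> * of_real s) / of_real (s\<^sup>2))"
  have e: "(e \<longlongrightarrow> - 1 / 2) (at 0)" unfolding e_def by (rule exp_i_expansion)
  have r: "?r \<noteq> 0" "?r * ?r = 5"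
    by (simp_all flip: of_real_mult)
  have d: "(d \<longlongrightarrow> 0) (at 0)"
    using tendsto_diff[OF branch_tendsto tendsto_const[of ?g]] by (simp add: d_def)
  have eq: "d s * (?r + d s) = exp (\<i> * of_real s) - 1" for s
  proof -
    have "d s * (?r + d s) = branch s * (branch s + 1) - ?g * (?g + 1)"
      unfolding golden_eqs_complex(1)[symmetric] by (simp add: d_def algebra_simps)
    then show ?thesis by (simp only: branch_eq golden_eqs_complex)
  qed
  have exp_eq: "exp (\<i> * of_real s) - 1 = \<i> * of_real s + e s * of_real (s\<^sup>2)" for s
    by (cases "s = 0") (simp_all add: e_def)
  have ne: "\<forall>\<^sub>F s in at 0. s \<noteq> 0 \<and> ?r + d s \<noteq> 0"
  proof (intro eventually_conj)
    have "((\<lambda>s. ?r + d s) \<longlongrightarrow> ?r + 0) (at 0)" by (intro tendsto_intros d)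
    then show "\<forall>\<^sub>F s in at 0. ?r + d s \<noteq> 0"
      using r(1) by (intro tendsto_imp_eventually_ne) auto
  qed (simp add: eventually_at_filter)
  have "((\<lambda>s. (\<i> + e s * of_real s) / (?r + d s)) \<longlongrightarrow> (\<i> + (- 1 / 2) * of_real 0) / (?r + 0)) (at 0)"
    using r(1) by (intro tendsto_intros e d) auto
  moreover have "\<forall>\<^sub>F s in at 0. (\<i> + e s * of_real s) / (?r + d s) = d s / of_real s"
    using ne
  proof eventually_elim
    case (elim s)
    then show ?case using eq[of s] exp_eq[of s]
      by (simp add: field_simps power2_eq_square)
  qed
  ultimately have d1: "((\<lambda>s. d s / of_real s) \<longlongrightarrow> \<i> / ?r) (at 0)"
    by (simp add: tendsto_cong)
  have "((\<lambda>s. (e s - (d s / of_real s)\<^sup>2) / ?r) \<longlongrightarrow> (- 1 / 2 - (\<i> / ?r)\<^sup>2) / ?r) (at 0)"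
    using r(1) by (intro tendsto_intros e d1) auto
  moreover have "(- 1 / 2 - (\<i> / ?r)\<^sup>2) / ?r = of_real (- 3 / (10 * sqrt 5))"
    using r by (simp add: power2_eq_square power_divide)
  moreover have "\<forall>\<^sub>F s in at 0. (e s - (d s / of_real s)\<^sup>2) / ?r =
      (branch s - ?g - \<i> * of_real s / ?r) / of_real (s\<^sup>2)"
    using ne
  proof eventually_elim
    case (elim s)
    have "d s * ?r = \<i> * of_real s + e s * of_real (s\<^sup>2) - (d s)\<^sup>2"
      using eq[of s] exp_eq[of s] by (simp add: algebra_simps power2_eq_square)
    then have "(d s - \<i> * of_real s / ?r) * ?r = of_real (s\<^sup>2) * (e s - (d s / of_real s)\<^sup>2)"
      using r(1) elim by (simp add: algebra_simps power_divide)
    then have "(e s - (d s / of_real s)\<^sup>2) / ?r = (d s - \<i> * of_real s / ?r) / of_real (s\<^sup>2)"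
      using r(1) elim by (simp add: divide_eq_eq eq_divide_eq mult_ac)
    then show ?case by (simp only: d_def)
  qed
  ultimately show ?thesis by (simp only: tendsto_cong)
qed

section \<open>Moments and the limit law\<close>

lemma closed_poly_normalised:
  assumes "x \<in> cball (complex_of_real golden) (1 / 2)"
  shows "closed_poly (x * (x + 1)) n =
    normalised n x * of_real (pochhammer golden n) * exp ((x - of_real golden) * of_real (shifted_harm n))"
proof -
  define w where "w = (x - of_real golden) * of_real (shifted_harm n)"
  have ne: "1 + 2 * x \<noteq> 0" using near_golden(2)[OF assms] .
  have p: "complex_of_real (pochhammer golden n) \<noteq> 0"
    using pochhammer_golden_pos[of n] by (metis less_irrefl of_real_eq_0_iff)
  have "normalised n x * of_real (pochhammer golden n) * exp w =
      ((x + 1) * pochhammer x n + x * pochhammer (- 1 - x) n) / (1 + 2 * x) * (exp (- w) * exp w)"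
  proof -
    have "a / (b * c) * f * c * d = a / b * (f * d)" if "c \<noteq> 0" for a b c d f :: complex
      using that by simp
    then show ?thesis unfolding normalised_def w_def[symmetric] using p .
  qed
  also have "\<dots> = closed_poly (x * (x + 1)) n"
    unfolding closed_poly_eq[OF refl, symmetric] using ne by (simp flip: exp_add)
  finally show ?thesis unfolding w_def ..
qed

lemma card_basis_perms:
  assumes "n > 0"
  shows "of_nat (card (basis_perms n)) = normalised n (of_real golden) * of_real (pochhammer golden n)"
proof -
  have "of_nat (card (basis_perms n)) = closed_poly 1 n"
    using sum_basis_perms[OF assms, of 1] by simp
  also have "\<dots> = closed_poly (of_real golden * (of_real golden + 1)) n"
    by (simp only: golden_eqs_complex)
  also have "\<dots> = normalised n (of_real golden) * of_real (pochhammer golden n)"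
    by (subst closed_poly_normalised) simp_all
  finally show ?thesis .
qed

lemma basis_perms_nonempty:
  assumes "n > 0" "normalised n (of_real golden) \<noteq> 0"
  shows "basis_perms n \<noteq> {}"
proof
  assume "basis_perms n = {}"
  then have "normalised n (of_real golden) * complex_of_real (pochhammer golden n) = 0"
    using card_basis_perms[OF assms(1)] by simp
  moreover have "complex_of_real (pochhammer golden n) \<noteq> 0"
    using pochhammer_golden_pos[of n] by (metis less_irrefl of_real_eq_0_iff)
  ultimately show False using assms(2) by simp
qed

text \<open>The left side is the probability generating function of the number of maxima at
  \<open>u = x (x + 1)\<close>; moments and characteristic functions are both read off from
  it.\<close>

lemma pgf_quasi_power:
  assumes "n > 0" "normalised n (of_real golden) \<noteq> 0" "x \<in> cball (complex_of_real golden) (1 / 2)"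
  shows "(\<Sum>\<sigma>\<in>basis_perms n. (x * (x + 1)) ^ num_ltr_max \<sigma>) / of_nat (card (basis_perms n)) =
    quasi_power n x * exp ((x - of_real golden) * of_real (shifted_harm n))"
proof -
  have "complex_of_real (pochhammer golden n) \<noteq> 0"
    using pochhammer_golden_pos[of n] by (metis less_irrefl of_real_eq_0_iff)
  then show ?thesis
    unfolding sum_basis_perms[OF assms(1)] card_basis_perms[OF assms(1)]
      closed_poly_normalised[OF assms(3)] quasi_power_def
    using assms(2) by simp
qed

text \<open>The value type is general because real moments and complex characteristic functions are
  both needed.\<close>

lemma expectation_U:
  fixes f :: "nat list \<Rightarrow> 'b::{banach, second_countable_topology}"
  assumes "basis_perms n \<noteq> {}"
  shows "measure_pmf.expectation (U n) f = (1 / card (basis_perms n)) *\<^sub>R (\<Sum>\<sigma>\<in>basis_perms n. f \<sigma>)"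
  unfolding U_def
  by (subst integral_measure_pmf[of "basis_perms n"])
    (use assms finite_basis_perms in \<open>auto simp: scaleR_sum_right\<close>)

lemma VarX_eq:
  assumes "basis_perms n \<noteq> {}"
  shows "VarX n = measure_pmf.expectation (U n) (\<lambda>\<sigma>. (real (num_ltr_max \<sigma>))\<^sup>2) - (meanX n)\<^sup>2"
proof -
  have fin: "finite (set_pmf (U n))"
    unfolding U_def using assms finite_basis_perms by simp
  show ?thesis
    unfolding VarX_def meanX_def
    by (rule measure_pmf.variance_eq) (auto intro: integrable_measure_pmf_finite fin)
qed

section \<open>Mean and variance\<close>

text \<open>\<open>G(x) = k(x) exp ((x - golden) h)\<close> is differentiated twice at
  \<open>golden\<close>, on both sides. By the chain rule for \<open>x (x + 1)\<close> the left side
  gives \<open>sqrt 5 E[X]\<close> and \<open>5 E[X (X - 1)] + 2 E[X]\<close>, the right side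
  \<open>k1 + h\<close> and \<open>k2 + 2 h k1 + h^2\<close>. Subtracting the square of the first
  from the second cancels \<open>h\<close>.\<close>

lemma moments:
  assumes n: "n > 0" and ne: "normalised n (of_real golden) \<noteq> 0"
  defines "k1 \<equiv> deriv (quasi_power n) (of_real golden)"
    and "k2 \<equiv> deriv (deriv (quasi_power n)) (of_real golden)"
  shows "complex_of_real (sqrt 5 * meanX n) = k1 + of_real (shifted_harm n)"
    and "complex_of_real (5 * VarX n - 3 * meanX n) = k2 - k1\<^sup>2"
proof -
  let ?g = "complex_of_real golden" and ?k = "quasi_power n"
  define h where "h = complex_of_real (shifted_harm n)"
  define S where "S = basis_perms n"
  define N where "N = complex_of_nat (card S)"
  have S: "S \<noteq> {}" unfolding S_def by (rule basis_perms_nonempty[OF n ne])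
  define X where "X = num_ltr_max"
  define e where "e = (\<lambda>x. exp ((x - ?g) * h))"
  define G where "G = (\<lambda>x. (\<Sum>\<sigma>\<in>S. (x * (x + 1)) ^ X \<sigma>) / N)"
  \<comment> \<open>Where \<open>X \<sigma> = 0\<close>, the truncated exponent
    \<open>X \<sigma> - 1\<close> is harmless, as the factor \<open>of_nat (X \<sigma>)\<close>
    vanishes.\<close>
  define G1 where "G1 = (\<lambda>x. (\<Sum>\<sigma>\<in>S. of_nat (X \<sigma>) * ((x * (x + 1)) ^ (X \<sigma> - 1) * (2 * x + 1))) / N)"
  have hol: "?k holomorphic_on ball ?g (1 / 2)"
    using quasi_power_holomorphic ball_subset_cball holomorphic_on_subset by blast
  have Geq: "G x = ?k x * e x" if "x \<in> ball ?g (1 / 2)" for x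
    using pgf_quasi_power[OF n ne, of x] that
    by (simp add: G_def S_def N_def X_def e_def h_def)
  have G_deriv: "(G has_field_derivative G1 x) (at x)" for x
    unfolding G_def G1_def
    by (intro DERIV_cdivide DERIV_sum) (auto intro!: derivative_eq_intros simp: algebra_simps)
  have e_deriv: "(e has_field_derivative h * e x) (at x)" for x
    unfolding e_def by (auto intro!: derivative_eq_intros)
  have k_deriv: "(?k has_field_derivative deriv ?k x) (at x)" if "x \<in> ball ?g (1 / 2)" for x
    using hol that holomorphic_derivI open_ball by blast
  have k_deriv2: "(deriv ?k has_field_derivative deriv (deriv ?k) x) (at x)" if "x \<in> ball ?g (1 / 2)" for x
    using holomorphic_deriv[OF hol open_ball] that holomorphic_derivI open_ball by blast
  have G1eq: "G1 x = (deriv ?k x + h * ?k x) * e x" if x: "x \<in> ball ?g (1 / 2)" for x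
  proof (rule DERIV_unique)
    have "((\<lambda>x. ?k x * e x) has_field_derivative G1 x) (at x)"
      by (rule has_field_derivative_transform_within_open[OF G_deriv open_ball x Geq])
    then show "((\<lambda>x. ?k x * e x) has_field_derivative G1 x) (at x)" .
    show "((\<lambda>x. ?k x * e x) has_field_derivative (deriv ?k x + h * ?k x) * e x) (at x)"
      by (rule derivative_eq_intros k_deriv[OF x] e_deriv)+ (simp add: algebra_simps)
  qed
  have g: "?g \<in> ball ?g (1 / 2)" by simp
  have k1: "?k ?g = 1" "e ?g = 1" using ne by (simp_all add: quasi_power_def e_def)
  have g1: "?g * (?g + 1) = 1" "2 * ?g + 1 = of_real (sqrt 5)"
    using golden_eqs_complex by (simp_all add: add.commute)
  \<comment> \<open>5 is the squared first derivative of \<open>x (x + 1)\<close> at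
    \<open>golden\<close>, and 2 is its second derivative.\<close>
  define G2 where "G2 = (\<Sum>\<sigma>\<in>S. of_nat (X \<sigma>) * (of_nat (X \<sigma> - 1) * 5 + 2)) / N"
  have G1_deriv: "(G1 has_field_derivative G2) (at ?g)"
    unfolding G1_def G2_def
  proof (intro DERIV_cdivide DERIV_sum DERIV_cmult)
    fix \<sigma>
    have "((\<lambda>x. (x * (x + 1)) ^ (X \<sigma> - 1) * (2 * x + 1)) has_field_derivative
        of_nat (X \<sigma> - 1) * ((?g * (?g + 1)) ^ (X \<sigma> - 1 - 1) * (2 * ?g + 1)) * (2 * ?g + 1) +
        2 * (?g * (?g + 1)) ^ (X \<sigma> - 1)) (at ?g)"
      by (auto intro!: derivative_eq_intros simp: algebra_simps)
    then show "((\<lambda>x. (x * (x + 1)) ^ (X \<sigma> - 1) * (2 * x + 1)) has_field_derivative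
        of_nat (X \<sigma> - 1) * 5 + 2) (at ?g)"
      unfolding g1 by (simp add: mult.assoc flip: of_real_mult)
  qed
  have "G2 = k2 + 2 * h * k1 + h\<^sup>2"
  proof (rule DERIV_unique)
    show "((\<lambda>x. (deriv ?k x + h * ?k x) * e x) has_field_derivative G2) (at ?g)"
      by (rule has_field_derivative_transform_within_open[OF G1_deriv open_ball g G1eq])
    have "((\<lambda>x. (deriv ?k x + h * ?k x) * e x) has_field_derivative
        (k2 + h * k1) * e ?g + (deriv ?k ?g + h * ?k ?g) * (h * e ?g)) (at ?g)"
      unfolding k1_def k2_def
      by (rule derivative_eq_intros k_deriv[OF g] k_deriv2[OF g] e_deriv refl)+ (simp add: algebra_simps)
    then show "((\<lambda>x. (deriv ?k x + h * ?k x) * e x) has_field_derivative k2 + 2 * h * k1 + h\<^sup>2) (at ?g)"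
      unfolding k1 k1_def[symmetric] by (simp add: algebra_simps power2_eq_square)
  qed
  define M2 where "M2 = measure_pmf.expectation (U n) (\<lambda>\<sigma>. (real (num_ltr_max \<sigma>))\<^sup>2)"
  have mean: "complex_of_real (meanX n) = (\<Sum>\<sigma>\<in>S. of_nat (X \<sigma>)) / N"
    unfolding meanX_def using S by (simp add: expectation_U S_def N_def X_def)
  have M2: "complex_of_real M2 = (\<Sum>\<sigma>\<in>S. (of_nat (X \<sigma>))\<^sup>2) / N"
    unfolding M2_def using S by (simp add: expectation_U S_def N_def X_def)
  have "G1 ?g = of_real (sqrt 5) * ((\<Sum>\<sigma>\<in>S. of_nat (X \<sigma>)) / N)"
    unfolding G1_def g1 by (simp add: mult.commute flip: sum_distrib_right)
  then show first: "complex_of_real (sqrt 5 * meanX n) = k1 + of_real (shifted_harm n)"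
    using G1eq[OF g] k1 mean by (simp add: k1_def h_def)
  have "of_nat m * (of_nat (m - 1) * 5 + 2) = 5 * (of_nat m)\<^sup>2 - 3 * (of_nat m :: complex)" for m
    by (cases m) (simp_all add: algebra_simps power2_eq_square)
  then have "G2 = 5 * of_real M2 - 3 * of_real (meanX n)"
    unfolding G2_def mean M2
    by (simp add: sum_subtractf diff_divide_distrib flip: sum_distrib_left)
  moreover have "complex_of_real (5 * VarX n - 3 * meanX n) =
      (5 * of_real M2 - 3 * of_real (meanX n)) - 5 * (of_real (meanX n))\<^sup>2"
  proof -
    have "VarX n = M2 - (meanX n)\<^sup>2"
      unfolding M2_def by (rule VarX_eq) (use S in \<open>simp add: S_def\<close>)
    then show ?thesis by (simp only:) (simp add: algebra_simps)
  qed
  moreover have "(k1 + h)\<^sup>2 = 5 * (complex_of_real (meanX n))\<^sup>2"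
  proof -
    have "(k1 + h)\<^sup>2 = of_real ((sqrt 5 * meanX n)\<^sup>2)" unfolding h_def first[symmetric] by simp
    also have "(sqrt 5 * meanX n)\<^sup>2 = 5 * (meanX n)\<^sup>2" by (simp add: power_mult_distrib)
    finally show ?thesis by simp
  qed
  ultimately have "complex_of_real (5 * VarX n - 3 * meanX n) = G2 - (k1 + h)\<^sup>2" by simp
  also have "\<dots> = k2 - k1\<^sup>2"
    unfolding \<open>G2 = k2 + 2 * h * k1 + h\<^sup>2\<close> by (simp add: algebra_simps power2_eq_square)
  finally show "complex_of_real (5 * VarX n - 3 * meanX n) = k2 - k1\<^sup>2" .
qed

lemma moment_bounds:
  "\<exists>K. \<forall>\<^sub>F n in sequentially. normalised n (of_real golden) \<noteq> 0 \<and> n > 0 \<and>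
     \<bar>sqrt 5 * meanX n - shifted_harm n\<bar> \<le> K \<and> \<bar>5 * VarX n - 3 * meanX n\<bar> \<le> K \<and>
     (\<forall>x \<in> cball (of_real golden) (1 / 4). norm (quasi_power n x - 1) \<le> K * norm (x - of_real golden))"
proof -
  obtain K where K: "\<forall>\<^sub>F n in sequentially. normalised n (of_real golden) \<noteq> 0 \<and>
     norm (deriv (quasi_power n) (of_real golden)) \<le> K \<and>
     norm (deriv (deriv (quasi_power n)) (of_real golden)) \<le> K \<and>
     (\<forall>x \<in> cball (of_real golden) (1 / 4). norm (quasi_power n x - 1) \<le> K * norm (x - of_real golden))"
    using quasi_power_bounds by blast
  show ?thesis
  \<comment> \<open>This constant serves all three estimates: the square accounts for
    \<open>k1\<close> squared in the variance identity.\<close>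
  proof (intro exI[of _ "K + K\<^sup>2"], use K eventually_gt_at_top[of 0] in eventually_elim)
    case (elim n)
    define k1 where "k1 = deriv (quasi_power n) (of_real golden)"
    define k2 where "k2 = deriv (deriv (quasi_power n)) (of_real golden)"
    have b: "norm k1 \<le> K" "norm k2 \<le> K" using elim by (simp_all add: k1_def k2_def)
    have K0: "0 \<le> K" using b(1) norm_ge_zero order_trans by blast
    have ne: "normalised n (of_real golden) \<noteq> 0" and n: "n > 0" using elim by auto
    have "of_real (sqrt 5 * meanX n - shifted_harm n) = k1"
      using moments(1)[OF n ne] by (simp add: k1_def)
    then have "\<bar>sqrt 5 * meanX n - shifted_harm n\<bar> = norm k1" by (metis norm_of_real)
    then have 1: "\<bar>sqrt 5 * meanX n - shifted_harm n\<bar> \<le> K + K\<^sup>2"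
      using b(1) by (simp add: add_increasing2)
    have "\<bar>5 * VarX n - 3 * meanX n\<bar> = norm (k2 - k1\<^sup>2)"
      using moments(2)[OF n ne] by (metis norm_of_real k1_def k2_def)
    also have "\<dots> \<le> norm k2 + norm (k1\<^sup>2)" by (rule norm_triangle_ineq4)
    also have "\<dots> \<le> K + K\<^sup>2"
      unfolding norm_power using b by (intro add_mono power_mono) auto
    finally have 2: "\<bar>5 * VarX n - 3 * meanX n\<bar> \<le> K + K\<^sup>2" .
    have "norm (quasi_power n x - 1) \<le> (K + K\<^sup>2) * norm (x - of_real golden)"
      if "x \<in> cball (of_real golden) (1 / 4)" for x
    proof -
      have "norm (quasi_power n x - 1) \<le> K * norm (x - of_real golden)" using elim that by blast
      also have "\<dots> \<le> (K + K\<^sup>2) * norm (x - of_real golden)"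
        by (intro mult_right_mono) auto
      finally show ?thesis .
    qed
    then show ?case using ne n 1 2 by blast
  qed
qed

lemma tendsto_over_at_top:
  fixes f g :: "nat \<Rightarrow> real"
  assumes "\<forall>\<^sub>F n in sequentially. \<bar>f n - c * g n\<bar> \<le> K" "filterlim g at_top sequentially"
  shows "(\<lambda>n. f n / g n) \<longlonglongrightarrow> c"
proof -
  have "(\<lambda>n. f n / g n - c) \<longlonglongrightarrow> 0"
  proof (rule Lim_null_comparison)
    show "(\<lambda>n. K / g n) \<longlonglongrightarrow> 0"
      by (rule tendsto_divide_0[OF tendsto_const filterlim_at_top_imp_at_infinity[OF assms(2)]])
    show "\<forall>\<^sub>F n in sequentially. norm (f n / g n - c) \<le> K / g n"
      using assms(1) filterlim_at_top_dense[THEN iffD1, OF assms(2), rule_format, of 0]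
    proof eventually_elim
      case (elim n)
      then have eq: "f n / g n - c = (f n - c * g n) / g n"
        by (simp add: diff_divide_distrib)
      show ?case unfolding eq using elim by (simp add: divide_right_mono)
    qed
  qed
  then show ?thesis by (simp add: LIM_zero_cancel)
qed

lemma meanX_ln: "(\<lambda>n. meanX n / ln (real n)) \<longlonglongrightarrow> 1 / sqrt 5"
proof -
  have "\<exists>K. \<forall>\<^sub>F n in sequentially. n > 0 \<and> \<bar>sqrt 5 * meanX n - shifted_harm n\<bar> \<le> K"
    using moment_bounds by (elim ex_forward eventually_mono) blast
  then obtain K where K: "\<forall>\<^sub>F n in sequentially. n > 0 \<and> \<bar>sqrt 5 * meanX n - shifted_harm n\<bar> \<le> K" ..
  have "(\<lambda>n. (sqrt 5 * meanX n) / ln (real n)) \<longlonglongrightarrow> 1"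
  proof (rule tendsto_over_at_top)
    show "filterlim (\<lambda>n. ln (real n)) at_top sequentially" by real_asymp
    show "\<forall>\<^sub>F n in sequentially. \<bar>sqrt 5 * meanX n - 1 * ln (real n)\<bar> \<le> K + 3"
      using K
    proof eventually_elim
      case (elim n)
      then show ?case using shifted_harm_ln[of n] by linarith
    qed
  qed
  then have "(\<lambda>n. (1 / sqrt 5) * ((sqrt 5 * meanX n) / ln (real n))) \<longlonglongrightarrow> (1 / sqrt 5) * 1"
    by (intro tendsto_intros)
  then show ?thesis by simp
qed

lemma meanX_at_top: "filterlim meanX at_top sequentially"
proof -
  have "filterlim (\<lambda>n. (meanX n / ln (real n)) * ln (real n)) at_top sequentially"
    by (rule filterlim_tendsto_pos_mult_at_top[OF meanX_ln]) (simp, real_asymp)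
  moreover have "\<forall>\<^sub>F n in sequentially. (meanX n / ln (real n)) * ln (real n) = meanX n"
    using eventually_gt_at_top[of 1] by eventually_elim simp
  ultimately show ?thesis by (simp only: filterlim_cong[OF refl refl])
qed

lemma VarX_over_meanX: "(\<lambda>n. VarX n / meanX n) \<longlonglongrightarrow> 3 / 5"
proof -
  have "\<exists>K. \<forall>\<^sub>F n in sequentially. \<bar>5 * VarX n - 3 * meanX n\<bar> \<le> K"
    using moment_bounds by (elim ex_forward eventually_mono) blast
  then obtain K where K: "\<forall>\<^sub>F n in sequentially. \<bar>5 * VarX n - 3 * meanX n\<bar> \<le> K" ..
  have "(\<lambda>n. (5 * VarX n) / meanX n) \<longlonglongrightarrow> 3"
    by (rule tendsto_over_at_top[OF K meanX_at_top])
  then have "(\<lambda>n. (1 / 5) * ((5 * VarX n) / meanX n)) \<longlonglongrightarrow> (1 / 5) * 3"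
    by (intro tendsto_intros)
  then show ?thesis by simp
qed

lemma VarX_at_top: "filterlim VarX at_top sequentially"
proof -
  have "filterlim (\<lambda>n. (VarX n / meanX n) * meanX n) at_top sequentially"
    by (rule filterlim_tendsto_pos_mult_at_top[OF VarX_over_meanX _ meanX_at_top]) simp
  moreover have "\<forall>\<^sub>F n in sequentially. (VarX n / meanX n) * meanX n = VarX n"
    using filterlim_at_top_dense[THEN iffD1, OF meanX_at_top, rule_format, of 0]
    by eventually_elim simp
  ultimately show ?thesis by (simp only: filterlim_cong[OF refl refl])
qed

section \<open>Convergence of the characteristic functions\<close>

lemma real_distribution_standardised:
  "real_distribution (distr (measure_pmf (U n)) borel
     (\<lambda>\<sigma>. (real (num_ltr_max \<sigma>) - meanX n) / sqrt (VarX n)))"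
  by (rule prob_space.real_distribution_distr[OF measure_pmf.prob_space_axioms]) simp

text \<open>Up to the phase from centring, this is the probability generating function at
  \<open>u = exp (i s)\<close>, and \<open>branch s\<close> is the corresponding
  \<open>x\<close>.\<close>

lemma char_standardised:
  assumes n: "n > 0" and ne: "normalised n (of_real golden) \<noteq> 0"
    and br: "branch s \<in> cball (complex_of_real golden) (1 / 2)"
    and s: "s = t / sqrt (VarX n)"
  shows "char (distr (measure_pmf (U n)) borel
            (\<lambda>\<sigma>. (real (num_ltr_max \<sigma>) - meanX n) / sqrt (VarX n))) t =
         quasi_power n (branch s) *
           exp ((branch s - of_real golden) * of_real (shifted_harm n) - \<i> * of_real (s * meanX n))"
proof -
  let ?S = "basis_perms n"
  have S: "?S \<noteq> {}" by (rule basis_perms_nonempty[OF n ne])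
  have "char (distr (measure_pmf (U n)) borel
            (\<lambda>\<sigma>. (real (num_ltr_max \<sigma>) - meanX n) / sqrt (VarX n))) t =
      measure_pmf.expectation (U n)
        (\<lambda>\<sigma>. exp (\<i> * of_real (t * ((real (num_ltr_max \<sigma>) - meanX n) / sqrt (VarX n)))))"
    unfolding char_def by (subst integral_distr) auto
  also have "(\<lambda>\<sigma>. exp (\<i> * complex_of_real (t * ((real (num_ltr_max \<sigma>) - meanX n) / sqrt (VarX n))))) =
      (\<lambda>\<sigma>. exp (- (\<i> * of_real (s * meanX n))) * (branch s * (branch s + 1)) ^ num_ltr_max \<sigma>)"
  proof
    fix \<sigma>
    have "\<i> * complex_of_real (t * ((real (num_ltr_max \<sigma>) - meanX n) / sqrt (VarX n))) =
        - (\<i> * of_real (s * meanX n)) + of_nat (num_ltr_max \<sigma>) * (\<i> * of_real s)"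
      by (simp add: s algebra_simps diff_divide_distrib)
    then show "exp (\<i> * complex_of_real (t * ((real (num_ltr_max \<sigma>) - meanX n) / sqrt (VarX n)))) =
        exp (- (\<i> * of_real (s * meanX n))) * (branch s * (branch s + 1)) ^ num_ltr_max \<sigma>"
      by (simp only: exp_add exp_of_nat_mult branch_eq)
  qed
  also have "measure_pmf.expectation (U n) \<dots> = exp (- (\<i> * of_real (s * meanX n))) *
      ((\<Sum>\<sigma>\<in>?S. (branch s * (branch s + 1)) ^ num_ltr_max \<sigma>) / of_nat (card ?S))"
    by (simp add: expectation_U[OF S] scaleR_conv_of_real flip: sum_distrib_left)
  also have "\<dots> = quasi_power n (branch s) * (exp ((branch s - of_real golden) * of_real (shifted_harm n))
      * exp (- (\<i> * of_real (s * meanX n))))"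
    unfolding pgf_quasi_power[OF n ne br] by (simp add: mult_ac)
  finally show ?thesis by (simp only: exp_add[symmetric] add_uminus_conv_diff)
qed

text \<open>As \<open>s = t / sqrt (VarX n)\<close> tends to 0, the factor
  \<open>quasi_power\<close> tends to 1. In the exponent the first-order part of the branch cancels
  the centring up to a vanishing error, and the second-order part produces the Gaussian.\<close>

lemma char_standardised_tendsto:
  "(\<lambda>n. char (distr (measure_pmf (U n)) borel
            (\<lambda>\<sigma>. (real (num_ltr_max \<sigma>) - meanX n) / sqrt (VarX n))) t) \<longlonglongrightarrow>
     char std_normal_distribution t"
proof (cases "t = 0")
  \<comment> \<open>For \<open>t = 0\<close> the sequence \<open>s\<close> is constantly 0, so the
    limits along \<open>at 0\<close> used below do not apply.\<close>
  case True
  then show ?thesis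
    by (simp add: real_distribution.char_zero[OF real_distribution_standardised]
        real_distribution.char_zero[OF real_dist_normal_dist])
next
  case False
  obtain K where K: "\<forall>\<^sub>F n in sequentially. normalised n (of_real golden) \<noteq> 0 \<and> n > 0 \<and>
     \<bar>sqrt 5 * meanX n - shifted_harm n\<bar> \<le> K \<and> \<bar>5 * VarX n - 3 * meanX n\<bar> \<le> K \<and>
     (\<forall>x \<in> cball (of_real golden) (1 / 4). norm (quasi_power n x - 1) \<le> K * norm (x - of_real golden))"
    using moment_bounds by blast
  let ?g = "complex_of_real golden"
  define s where "s = (\<lambda>n. t / sqrt (VarX n))"
  define \<delta> where "\<delta> = (\<lambda>n. branch (s n) - ?g)"
  define a where "a = (\<lambda>n. sqrt 5 * meanX n - shifted_harm n)"
  define R where "R = (\<lambda>n. (\<delta> n - \<i> * of_real (s n) / of_real (sqrt 5)) / of_real ((s n)\<^sup>2))"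
  have varpos: "\<forall>\<^sub>F n in sequentially. VarX n > 0"
    using filterlim_at_top_dense[THEN iffD1, OF VarX_at_top, rule_format, of 0] .
  have "filterlim (\<lambda>n. sqrt (VarX n)) at_top sequentially"
    by (rule filterlim_compose[OF sqrt_at_top VarX_at_top])
  then have s0: "s \<longlonglongrightarrow> 0"
    unfolding s_def
    by (intro tendsto_divide_0[OF tendsto_const] filterlim_at_top_imp_at_infinity)
  have sne: "\<forall>\<^sub>F n in sequentially. s n \<noteq> 0"
    using varpos by eventually_elim (use False in \<open>simp add: s_def\<close>)
  have sat: "filterlim s (at 0) sequentially"
    using s0 sne by (simp add: filterlim_at)
  have \<delta>0: "\<delta> \<longlonglongrightarrow> 0"
    using tendsto_diff[OF filterlim_compose[OF branch_tendsto sat] tendsto_const[of ?g]]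
    by (simp add: \<delta>_def)
  have R: "R \<longlonglongrightarrow> of_real (- 3 / (10 * sqrt 5))"
    unfolding R_def \<delta>_def by (rule filterlim_compose[OF branch_expansion sat])
  have s2mean: "(\<lambda>n. (s n)\<^sup>2 * meanX n) \<longlonglongrightarrow> t\<^sup>2 * (5 / 3)"
  proof -
    have "(\<lambda>n. t\<^sup>2 * inverse (VarX n / meanX n)) \<longlonglongrightarrow> t\<^sup>2 * inverse (3 / 5)"
      by (intro tendsto_intros VarX_over_meanX) auto
    moreover have "\<forall>\<^sub>F n in sequentially. t\<^sup>2 * inverse (VarX n / meanX n) = (s n)\<^sup>2 * meanX n"
      using varpos by eventually_elim (simp add: s_def power_divide)
    ultimately show ?thesis by (simp add: tendsto_cong)
  qed
  have abd: "\<forall>\<^sub>F n in sequentially. \<bar>a n\<bar> \<le> K"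
    using K by eventually_elim (simp add: a_def)
  have sa: "(\<lambda>n. s n * a n) \<longlonglongrightarrow> 0"
  proof (rule Lim_null_comparison)
    show "\<forall>\<^sub>F n in sequentially. norm (s n * a n) \<le> \<bar>s n\<bar> * K"
      using abd by eventually_elim (simp add: abs_mult mult_left_mono)
    show "(\<lambda>n. \<bar>s n\<bar> * K) \<longlonglongrightarrow> 0"
      using s0 by (auto intro!: tendsto_eq_intros)
  qed
  \<comment> \<open>The expansion \<open>\<delta> = i s / sqrt 5 + R s^2\<close> is multiplied by
    \<open>shifted_harm = sqrt 5 * meanX - a\<close>. The term \<open>i s meanX\<close> cancels and
    the terms with the bounded \<open>a\<close> vanish; the remaining one has the limit
    \<open>- 3 / (10 sqrt 5) * sqrt 5 * (5 / 3) t^2 = - t^2 / 2\<close>.\<close>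
  define E where "E = (\<lambda>n. - (\<i> * of_real (s n * a n) / of_real (sqrt 5)) +
      R n * of_real (sqrt 5 * ((s n)\<^sup>2 * meanX n)) - R n * of_real (s n * (s n * a n)))"
  have "E \<longlonglongrightarrow> - (\<i> * of_real 0 / of_real (sqrt 5)) +
      of_real (- 3 / (10 * sqrt 5)) * of_real (sqrt 5 * (t\<^sup>2 * (5 / 3))) -
      of_real (- 3 / (10 * sqrt 5)) * of_real (0 * 0)"
    unfolding E_def by (intro tendsto_intros R sa s0 s2mean) auto
  also have "- (\<i> * of_real 0 / of_real (sqrt 5)) +
      of_real (- 3 / (10 * sqrt 5)) * of_real (sqrt 5 * (t\<^sup>2 * (5 / 3))) -
      of_real (- 3 / (10 * sqrt 5)) * of_real (0 * 0) = complex_of_real (- (t\<^sup>2) / 2)"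
    unfolding of_real_mult[symmetric] by simp
  finally have Elim: "E \<longlonglongrightarrow> of_real (- (t\<^sup>2) / 2)" .
  have Eeq: "\<forall>\<^sub>F n in sequentially.
      \<delta> n * of_real (shifted_harm n) - \<i> * of_real (s n * meanX n) = E n"
    using sne
  proof eventually_elim
    case (elim n)
    define r where "r = complex_of_real (sqrt 5)"
    have r: "r * r = 5" "r \<noteq> 0" unfolding r_def by (simp_all flip: of_real_mult)
    have \<delta>: "\<delta> n = \<i> * of_real (s n) / r + R n * of_real (s n) * of_real (s n)"
      using elim by (simp add: R_def r_def power2_eq_square)
    have h: "complex_of_real (shifted_harm n) = r * of_real (meanX n) - of_real (a n)"
      by (simp add: a_def r_def)
    show ?case
      unfolding E_def h \<delta> r_def[symmetric] of_real_mult of_real_power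
      using r(2) by (simp add: algebra_simps power2_eq_square)
  qed
  have klim: "(\<lambda>n. quasi_power n (branch (s n))) \<longlonglongrightarrow> 1"
  proof (rule LIM_zero_cancel, rule Lim_null_comparison)
    show "(\<lambda>n. K * norm (\<delta> n)) \<longlonglongrightarrow> 0"
      using \<delta>0 by (auto intro!: tendsto_eq_intros)
    have "\<forall>\<^sub>F n in sequentially. dist (\<delta> n) 0 < 1 / 4"
      by (rule tendstoD[OF \<delta>0]) simp
    then show "\<forall>\<^sub>F n in sequentially. norm (quasi_power n (branch (s n)) - 1) \<le> K * norm (\<delta> n)"
      using K by eventually_elim (auto simp: \<delta>_def dist_norm norm_minus_commute)
  qed
  have "(\<lambda>n. quasi_power n (branch (s n)) * exp (E n)) \<longlonglongrightarrow> 1 * exp (of_real (- (t\<^sup>2) / 2))"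
    by (intro tendsto_intros klim Elim)
  moreover have "\<forall>\<^sub>F n in sequentially. quasi_power n (branch (s n)) * exp (E n) =
      char (distr (measure_pmf (U n)) borel
            (\<lambda>\<sigma>. (real (num_ltr_max \<sigma>) - meanX n) / sqrt (VarX n))) t"
  proof -
    have "\<forall>\<^sub>F n in sequentially. dist (\<delta> n) 0 < 1 / 2"
      by (rule tendstoD[OF \<delta>0]) simp
    then show ?thesis
      using K Eeq
    proof eventually_elim
      case (elim n)
      then have "branch (s n) \<in> cball ?g (1 / 2)"
        by (simp add: \<delta>_def dist_norm norm_minus_commute)
      then show ?case
        using elim by (subst char_standardised[of n "s n"]) (simp_all add: s_def \<delta>_def)
    qed
  qed
  ultimately have "(\<lambda>n. char (distr (measure_pmf (U n)) borel
            (\<lambda>\<sigma>. (real (num_ltr_max \<sigma>) - meanX n) / sqrt (VarX n))) t)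
      \<longlonglongrightarrow> 1 * exp (of_real (- (t\<^sup>2) / 2))"
    by (rule Lim_transform_eventually)
  then show ?thesis by (simp only: char_std_normal_distribution exp_of_real mult_1)
qed

theorem mainTheorem10:
  shows "(\<lambda>n. meanX n) \<sim>[at_top] (\<lambda>n. ln (real n) / sqrt 5)
       \<and> weak_conv_m
           (\<lambda>n. distr (measure_pmf (U n)) borel
                   (\<lambda>\<sigma>. (real (num_ltr_max \<sigma>) - meanX n) / sqrt (VarX n)))
           std_normal_distribution
       \<and> (\<lambda>n. real n - 1 - meanX n) \<sim>[at_top] (\<lambda>n. real n - ln (real n) / sqrt 5)"
proof (intro conjI)
  show "(\<lambda>n. meanX n) \<sim>[at_top] (\<lambda>n. ln (real n) / sqrt 5)"
  proof (rule asymp_equivI')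
    have "(\<lambda>n. sqrt 5 * (meanX n / ln (real n))) \<longlonglongrightarrow> sqrt 5 * (1 / sqrt 5)"
      by (intro tendsto_intros meanX_ln)
    then show "(\<lambda>n. meanX n / (ln (real n) / sqrt 5)) \<longlonglongrightarrow> 1"
      by (simp add: mult.commute)
  qed
  show "weak_conv_m (\<lambda>n. distr (measure_pmf (U n)) borel
          (\<lambda>\<sigma>. (real (num_ltr_max \<sigma>) - meanX n) / sqrt (VarX n))) std_normal_distribution"
    by (rule levy_continuity[OF real_distribution_standardised real_dist_normal_dist char_standardised_tendsto])
  \<comment> \<open>The mean is of logarithmic order, so both sides of the last claim are equivalent
    to \<open>n\<close>.\<close>
  have lim0: "(\<lambda>n. meanX n / real n) \<longlonglongrightarrow> 0"
  proof -
    have "(\<lambda>n. ln (real n) / real n) \<longlonglongrightarrow> 0" by real_asymp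
    from tendsto_mult[OF meanX_ln this]
    have "(\<lambda>n. meanX n / ln (real n) * (ln (real n) / real n)) \<longlonglongrightarrow> 0" by simp
    moreover have "\<forall>\<^sub>F n in sequentially. meanX n / ln (real n) * (ln (real n) / real n) = meanX n / real n"
      using eventually_gt_at_top[of 1] by eventually_elim simp
    ultimately show ?thesis by (rule Lim_transform_eventually)
  qed
  show "(\<lambda>n. real n - 1 - meanX n) \<sim>[at_top] (\<lambda>n. real n - ln (real n) / sqrt 5)"
  proof (rule asymp_equiv_trans)
    show "(\<lambda>n. real n - 1 - meanX n) \<sim>[at_top] (\<lambda>n. real n)"
    proof (rule asymp_equivI')
      have "(\<lambda>n. 1 - 1 / real n - meanX n / real n) \<longlonglongrightarrow> 1 - 0 - 0"
        by (intro tendsto_intros lim0 lim_1_over_n)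
      moreover have "\<forall>\<^sub>F n in sequentially. 1 - 1 / real n - meanX n / real n = (real n - 1 - meanX n) / real n"
        using eventually_gt_at_top[of 0] by eventually_elim (simp add: field_simps)
      ultimately show "(\<lambda>n. (real n - 1 - meanX n) / real n) \<longlonglongrightarrow> 1" by (simp add: tendsto_cong)
    qed
    show "(\<lambda>n. real n) \<sim>[at_top] (\<lambda>n. real n - ln (real n) / sqrt 5)"
      by real_asymp
  qed
qed

end
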